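(* Let $\nu\in(0,1)$ and let $\pi_\nu^X\propto\exp(-V_\nu)$ be the generalized Cauchy density on $\mathbb{R}^d$, $V_\nu(x)=\frac{d+\nu}{2}\ln(1+|x|^2)$. Let $x_k$ denote the $k$-th iterate of the stable proximal sampler with $\alpha=1$ and target $\pi_\nu^X$, and $\rho_k^X=\mathrm{Law}(x_k)$. Choose the step size $\eta=\Theta\big(L^{-4/\nu}d^{-1/2}\big)$, where $L=\frac{d+\nu}{\nu}$ is the $\nu/4$-Hölder constant of $V_\nu$, and assume $|x_0|\le\mathcal{O}(\sqrt d)$. Then $\mathrm{TV}(\pi_\nu^X,\rho_N^X)\le\varepsilon$ requires $$N\ge\Omega_{\nu,\tau}\Big(d^{\frac{\tau+8\tau/\nu}{2+\tau}}\,\varepsilon^{-\frac{2(\tau-\nu)}{\nu(2+\tau)}}\Big)\quad\text{for any }\tau\in(\nu,1).$$ Further, by choosing $\tau=\max\big(\nu,1-\frac{\log(\log(d/\varepsilon))}{\log(d/\varepsilon)}\big)$, one obtains that $\mathrm{TV}(\pi_\nu^X,\rho_N^X)\le\varepsilon$ requires $$N\ge\tilde\Omega_\nu\Big(d^{\frac{\nu+8}{3\nu}}\,\varepsilon^{-\frac{2(1-\nu)}{3\nu}}\Big).$$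
   Context: $|\cdot|$ is the Euclidean norm and $\mathrm{TV}(\mu,\nu)=\sup_A|\mu(A)-\nu(A)|$. Let $p^{(1)}(\eta;x,y)=p_\eta^{(1)}(y-x)$, where $p_\eta^{(1)}(z)\propto(|z|^2+\eta^2)^{-(d+1)/2}$ is the isotropic $1$-stable (Cauchy) density. Stable proximal sampler with $\alpha=1$, step $\eta>0$, target $\pi^X$: started from a (random) $x_0$, at each iteration $k=0,1,\dots$ (i) sample $y_k\mid x_k\sim p^{(1)}(\eta;x_k,\cdot)$; (ii) sample $x_{k+1}\mid y_k$ (exactly, by rejection sampling) from the density proportional to $\pi^X(\cdot)\,p^{(1)}(\eta;\cdot,y_k)$. $|x_0|\le\mathcal{O}(\sqrt d)$ means $|x_0|\le C_0\sqrt d$ almost surely for an absolute constant $C_0$. $\Omega_{\nu,\tau}$ hides a positive constant depending only on $\nu,\tau$ (and on $C_0$ and the constants in $\Theta$); $\tilde\Omega_\nu$ hides constants depending only on $\nu$ (and on $C_0$ and the constants in $\Theta$) and factors polylogarithmic in $d$ and $1/\varepsilon$. Lower bounds are for all sufficiently small $\varepsilon>0$. *)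

theory Defs
  imports "HOL-Probability.Probability"
begin

text \<open>
  The dimension d is a natural number, not a type, because the hidden constants in the theorem
  have to be chosen uniformly in d.  Points of d-dimensional space are functions on
  \<^term>\<open>{..<d}\<close> (extensional, as in \<^const>\<open>PiM\<close>), and \<^term>\<open>Rd d\<close> carries d-dimensional Lebesgue
  (Borel) measure.
\<close>

definition Rd :: "nat \<Rightarrow> (nat \<Rightarrow> real) measure" where
  "Rd d = (\<Pi>\<^sub>M i\<in>{..<d}. lborel)"

definition euclid_norm :: "nat \<Rightarrow> (nat \<Rightarrow> real) \<Rightarrow> real" where
  "euclid_norm d x = L2_set x {..<d}"

definition tv_dist :: "'a measure \<Rightarrow> 'a measure \<Rightarrow> real" where
  "tv_dist M N = (SUP A\<in>sets M. \<bar>measure M A - measure N A\<bar>)"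

text \<open>The probability density proportional to f; it is used for f with finite positive integral.\<close>

definition normalize_pdf :: "'a measure \<Rightarrow> ('a \<Rightarrow> ennreal) \<Rightarrow> 'a \<Rightarrow> ennreal" where
  "normalize_pdf M f x = f x / (\<integral>\<^sup>+ z. f z \<partial>M)"

definition potential :: "nat \<Rightarrow> real \<Rightarrow> (nat \<Rightarrow> real) \<Rightarrow> real" where
  "potential d \<nu> x = (real d + \<nu>) / 2 * ln (1 + (euclid_norm d x)\<^sup>2)"

definition target_pdf :: "nat \<Rightarrow> real \<Rightarrow> (nat \<Rightarrow> real) \<Rightarrow> ennreal" where
  "target_pdf d \<nu> = normalize_pdf (Rd d) (\<lambda>x. ennreal (exp (- potential d \<nu> x)))"

definition target :: "nat \<Rightarrow> real \<Rightarrow> (nat \<Rightarrow> real) measure" where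
  "target d \<nu> = density (Rd d) (target_pdf d \<nu>)"

definition cauchy_pdf :: "nat \<Rightarrow> real \<Rightarrow> (nat \<Rightarrow> real) \<Rightarrow> ennreal" where
  "cauchy_pdf d \<eta> =
     normalize_pdf (Rd d) (\<lambda>z. ennreal (((euclid_norm d z)\<^sup>2 + \<eta>\<^sup>2) powr (- (real d + 1) / 2)))"

definition transition_pdf :: "nat \<Rightarrow> real \<Rightarrow> (nat \<Rightarrow> real) \<Rightarrow> (nat \<Rightarrow> real) \<Rightarrow> ennreal" where
  "transition_pdf d \<eta> x y = cauchy_pdf d \<eta> (\<lambda>i\<in>{..<d}. y i - x i)"

definition forward_kernel :: "nat \<Rightarrow> real \<Rightarrow> (nat \<Rightarrow> real) \<Rightarrow> (nat \<Rightarrow> real) measure" where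
  "forward_kernel d \<eta> x = density (Rd d) (transition_pdf d \<eta> x)"

definition backward_kernel ::
    "nat \<Rightarrow> ((nat \<Rightarrow> real) \<Rightarrow> ennreal) \<Rightarrow> real \<Rightarrow> (nat \<Rightarrow> real) \<Rightarrow> (nat \<Rightarrow> real) measure" where
  "backward_kernel d \<pi> \<eta> y =
     density (Rd d) (normalize_pdf (Rd d) (\<lambda>x. \<pi> x * transition_pdf d \<eta> x y))"

text \<open>
  \<^term>\<open>sampler_law d \<pi> \<eta> \<rho>\<^sub>0 k\<close> is the law of the k-th iterate of the stable proximal sampler
  (with stability index 1, step \<^term>\<open>\<eta>\<close> and target density \<^term>\<open>\<pi>\<close>), where \<^term>\<open>\<rho>\<^sub>0\<close> is the law of
  the initial point.
\<close>

primrec sampler_law ::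
    "nat \<Rightarrow> ((nat \<Rightarrow> real) \<Rightarrow> ennreal) \<Rightarrow> real \<Rightarrow> (nat \<Rightarrow> real) measure \<Rightarrow> nat \<Rightarrow> (nat \<Rightarrow> real) measure"
where
  "sampler_law d \<pi> \<eta> \<rho>\<^sub>0 0 = \<rho>\<^sub>0"
| "sampler_law d \<pi> \<eta> \<rho>\<^sub>0 (Suc k) =
     (sampler_law d \<pi> \<eta> \<rho>\<^sub>0 k \<bind> forward_kernel d \<eta>) \<bind> backward_kernel d \<pi> \<eta>"

definition bounded_init :: "nat \<Rightarrow> real \<Rightarrow> (nat \<Rightarrow> real) measure \<Rightarrow> bool" where
  "bounded_init d C\<^sub>0 \<rho>\<^sub>0 \<longleftrightarrow>
     prob_space \<rho>\<^sub>0 \<and> sets \<rho>\<^sub>0 = sets (Rd d) \<and> (AE x in \<rho>\<^sub>0. euclid_norm d x \<le> C\<^sub>0 * sqrt (real d))"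

text \<open>
  Up to a numerical factor this is the constant L of \<open>\<nu>/4\<close>-Hoelder continuity of the potential; it
  enters only through the scaling of the step size.
\<close>

definition holder_const :: "nat \<Rightarrow> real \<Rightarrow> real" where
  "holder_const d \<nu> = (real d + \<nu>) / \<nu>"

text \<open>The step size is of order \<open>L\<^bsup>-4/\<nu>\<^esup> d\<^bsup>-1/2\<^esup>\<close>, with explicit constants \<^term>\<open>c\<^sub>1\<close> and \<^term>\<open>c\<^sub>2\<close>.\<close>

definition step_size_order :: "real \<Rightarrow> real \<Rightarrow> nat \<Rightarrow> real \<Rightarrow> real \<Rightarrow> bool" where
  "step_size_order c\<^sub>1 c\<^sub>2 d \<nu> \<eta> \<longleftrightarrow>
     c\<^sub>1 * (holder_const d \<nu> powr (- 4 / \<nu>) * real d powr (- 1 / 2)) \<le> \<eta> \<and>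
     \<eta> \<le> c\<^sub>2 * (holder_const d \<nu> powr (- 4 / \<nu>) * real d powr (- 1 / 2))"

definition iteration_rate :: "real \<Rightarrow> real \<Rightarrow> nat \<Rightarrow> real \<Rightarrow> real" where
  "iteration_rate \<nu> \<tau> d \<epsilon> =
     real d powr ((\<tau> + 8 * \<tau> / \<nu>) / (2 + \<tau>)) * \<epsilon> powr (- (2 * (\<tau> - \<nu>)) / (\<nu> * (2 + \<tau>)))"

definition tau_choice :: "real \<Rightarrow> nat \<Rightarrow> real \<Rightarrow> real" where
  "tau_choice \<nu> d \<epsilon> = max \<nu> (1 - ln (ln (real d / \<epsilon>)) / ln (real d / \<epsilon>))"

end

theory Submission
  imports Defs
begin

text \<open>
  Fix \<open>\<nu> < \<tau> < 1\<close>.  Since the target is radially decreasing, the backward step only shortens the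
  iterate compared with a fresh Cauchy step from y (Chebyshev's association inequality), and
  \<open>t \<mapsto> t\<^sup>\<tau>\<close> is subadditive; hence one iteration increases \<open>E|x\<^sub>k|\<^sup>\<tau>\<close> by at most
  \<open>2 E|\<eta>Z|\<^sup>\<tau> = O((\<eta> \<surd>d)\<^sup>\<tau>)\<close>.  The target has tails of order \<open>(\<surd>d / R)\<^sup>\<nu>\<close>, so total variation
  distance \<open>\<epsilon>\<close> together with Markov's inequality at \<open>R \<approx> \<surd>d \<epsilon>\<^bsup>-1/\<nu>\<^esup>\<close> forces
  \<open>N \<ge> c d\<^bsup>\<tau>(1/2+4/\<nu>)\<^esup> \<epsilon>\<^bsup>-(\<tau>-\<nu>)/\<nu>\<^esup>\<close>.  The claimed rate is the \<open>2/(2+\<tau>)\<close>-th power of this bound, and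
  the fixed exponent \<open>\<tau> = (2+\<nu>)/3\<close> already yields the second bound on N.
\<close>

section \<open>Radial integration\<close>

text \<open>Everything has to be uniform in d, so the normalising constants of the target and of the
  Cauchy step are never computed. Each is compared with the tail integral in question: both carry
  the factor d times the volume of the unit ball, which cancels, and beyond radius sqrt d (times the
  scale of the density) the density is a pure power up to a factor e. Hence sqrt d is the unit of
  length throughout: its powers in the initial point, the cutoff R and the steps cancel, and d
  survives only through the step size. The exponent must lie below 1 because a Cauchy step has no
  first moment, and above \<nu> because only then does R^\<tau> times the target tail R^(-\<nu>)
  grow with R. The constant of the first bound is chosen after \<tau> and contains 1 / (1 - \<tau>),
  so a \<tau> that moves with \<epsilon> cannot simply be inserted. The second bound on N therefore
  uses one fixed \<tau>, and the rate at the prescribed moving \<tau> is treated separately, as a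
  statement about exponents alone.\<close>

lemma measurable_euclid_norm [measurable]: "euclid_norm d \<in> borel_measurable (Rd d)"
  unfolding euclid_norm_def L2_set_def Rd_def by measurable

lemma euclid_norm_nonneg [simp]: "0 \<le> euclid_norm d x"
  by (simp add: euclid_norm_def)

interpretation lborel_product: product_sigma_finite "\<lambda>_::nat. lborel :: real measure"
  by standard

lemma sigma_finite_Rd: "sigma_finite_measure (Rd d)"
  unfolding Rd_def by (intro lborel_product.sigma_finite) auto

section \<open>Differences of points and reflection invariance of Lebesgue measure\<close>

definition diff_Rd :: "nat \<Rightarrow> (nat \<Rightarrow> real) \<Rightarrow> (nat \<Rightarrow> real) \<Rightarrow> nat \<Rightarrow> real" where
  "diff_Rd d y x = (\<lambda>i\<in>{..<d}. y i - x i)"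

lemma measurable_component_Rd: "i < d \<Longrightarrow> (\<lambda>x. x i) \<in> borel_measurable (Rd d)"
  unfolding Rd_def by measurable

lemma measurable_diff_Rd [measurable (raw)]:
  assumes "f \<in> measurable M (Rd d)" "g \<in> measurable M (Rd d)"
  shows "(\<lambda>z. diff_Rd d (f z) (g z)) \<in> measurable M (Rd d)"
proof -
  have "(\<lambda>z. f z i) \<in> borel_measurable M" "(\<lambda>z. g z i) \<in> borel_measurable M" if "i < d" for i
    using that by (auto intro!: measurable_compose[OF assms(1)] measurable_compose[OF assms(2)] measurable_component_Rd)
  then show ?thesis
    unfolding diff_Rd_def Rd_def by (intro measurable_restrict) auto
qed

lemma diff_Rd_in_space [simp]: "diff_Rd d y x \<in> space (Rd d)"
  by (auto simp: diff_Rd_def Rd_def space_PiM)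

lemma emeasure_lborel_reflect:
  assumes [measurable]: "A \<in> sets borel"
  shows "emeasure lborel ((\<lambda>x::real. t - x) -` A) = emeasure lborel A"
proof -
  have "emeasure lborel A = emeasure (density (distr lborel borel (\<lambda>x. t + (-1) * x)) (\<lambda>_. ennreal \<bar>-1\<bar>)) A"
    using lborel_real_affine[of "-1" t] by simp
  also have "\<dots> = emeasure (distr lborel borel (\<lambda>x. t - x)) A"
    by (simp add: density_1)
  also have "\<dots> = emeasure lborel ((\<lambda>x::real. t - x) -` A)"
    by (subst emeasure_distr) auto
  finally show ?thesis ..
qed

text \<open>A product measure is determined by its values on boxes, and x -> y - x pulls a box back
  to the box of the reflected sides. The reflection, rather than a translation, is the map that
  occurs in the argument of the Cauchy density.\<close>

lemma distr_diff_Rd: "distr (Rd d) (Rd d) (diff_Rd d y) = Rd d"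
proof -
  have [measurable]: "diff_Rd d y \<in> measurable (Rd d) (Rd d)"
  proof -
    have "(\<lambda>x. y i - x i) \<in> borel_measurable (Rd d)" if "i < d" for i
      using measurable_component_Rd[OF that] by measurable
    then show ?thesis
      unfolding diff_Rd_def Rd_def by (intro measurable_restrict) auto
  qed
  show ?thesis
    unfolding Rd_def
  proof (rule lborel_product.PiM_eqI)
    fix A assume A: "\<And>i. i \<in> {..<d} \<Longrightarrow> A i \<in> sets (lborel :: real measure)"
    have [measurable]: "Pi\<^sub>E {..<d} A \<in> sets (Rd d)"
      unfolding Rd_def using A by (intro sets_PiM_I_finite) auto
    have "emeasure (distr (Rd d) (Rd d) (diff_Rd d y)) (Pi\<^sub>E {..<d} A)
      = emeasure (Rd d) (diff_Rd d y -` Pi\<^sub>E {..<d} A \<inter> space (Rd d))"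
      by (intro emeasure_distr) auto
    also have "diff_Rd d y -` Pi\<^sub>E {..<d} A \<inter> space (Rd d) = Pi\<^sub>E {..<d} (\<lambda>i. (\<lambda>x. y i - x) -` A i)"
      by (auto simp: diff_Rd_def Rd_def space_PiM PiE_iff)
    also have "emeasure (Rd d) \<dots> = (\<Prod>i<d. emeasure lborel ((\<lambda>x. y i - x) -` A i))"
      unfolding Rd_def using A
      by (intro lborel_product.emeasure_PiM) (auto intro!: measurable_sets_borel[of _ borel])
    also have "\<dots> = (\<Prod>i<d. emeasure lborel (A i))"
      using A by (intro prod.cong refl emeasure_lborel_reflect) auto
    finally show "emeasure (distr (Pi\<^sub>M {..<d} (\<lambda>i. lborel)) (Pi\<^sub>M {..<d} (\<lambda>i. lborel)) (diff_Rd d y)) (Pi\<^sub>E {..<d} A)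
       = (\<Prod>i\<in>{..<d}. emeasure lborel (A i))"
      unfolding Rd_def .
  qed auto
qed

lemma nn_integral_diff_Rd:
  assumes y: "y \<in> space (Rd d)" and [measurable]: "h \<in> borel_measurable (Rd d)"
  shows "(\<integral>\<^sup>+ x. h (diff_Rd d y x) \<partial>Rd d) = (\<integral>\<^sup>+ x. h x \<partial>Rd d)"
proof -
  have "(\<integral>\<^sup>+ x. h x \<partial>Rd d) = (\<integral>\<^sup>+ x. h x \<partial>distr (Rd d) (Rd d) (diff_Rd d y))"
    by (simp add: distr_diff_Rd)
  also have "\<dots> = (\<integral>\<^sup>+ x. h (diff_Rd d y x) \<partial>Rd d)"
    using y by (intro nn_integral_distr) auto
  finally show ?thesis ..
qed

lemma euclid_norm_diff_Rd_commute: "euclid_norm d (diff_Rd d x y) = euclid_norm d (diff_Rd d y x)"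
  unfolding euclid_norm_def diff_Rd_def L2_set_def
  by (intro arg_cong[of _ _ sqrt] sum.cong) (auto simp: power2_commute)

lemma euclid_norm_triangle: "euclid_norm d x \<le> euclid_norm d y + euclid_norm d (diff_Rd d y x)"
proof -
  have "euclid_norm d x = L2_set (\<lambda>i. y i + (x i - y i)) {..<d}"
    by (simp add: euclid_norm_def)
  also have "\<dots> \<le> L2_set y {..<d} + L2_set (\<lambda>i. x i - y i) {..<d}"
    by (rule L2_set_triangle_ineq)
  also have "L2_set (\<lambda>i. x i - y i) {..<d} = euclid_norm d (diff_Rd d y x)"
    unfolding euclid_norm_def diff_Rd_def L2_set_def
    by (intro arg_cong[of _ _ sqrt] sum.cong) (auto simp: power2_commute)
  finally show ?thesis by (simp add: euclid_norm_def)
qed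

section \<open>Polar coordinates for functions of the norm\<close>

lemma emeasure_ball_Rd:
  assumes "r > 0"
  shows "emeasure (Rd d) {x \<in> space (Rd d). euclid_norm d x \<le> r} = ennreal (unit_ball_vol d * r ^ d)"
proof -
  have "{x \<in> space (Rd d). euclid_norm d x \<le> r}
     = {f. sqrt (\<Sum>i<d. (f i)\<^sup>2) \<le> r} \<inter> space (Pi\<^sub>M {..<d} (\<lambda>_. lborel))"
    by (auto simp: Rd_def euclid_norm_def L2_set_def)
  with emeasure_cball_aux[of "{..<d}" r] assms show ?thesis
    by (simp add: Rd_def)
qed

lemma nn_integral_power_Icc:
  assumes "r \<ge> 0" "d \<ge> 1"
  shows "(\<integral>\<^sup>+ x. ennreal (d * x ^ (d - 1)) * indicator {0..r} x \<partial>lborel) = ennreal (r ^ d)"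
proof -
  have "(\<integral>\<^sup>+ x. ennreal (d * x ^ (d - 1)) * indicator {0..r} x \<partial>lborel) = ennreal (r ^ d - 0 ^ d)"
    by (rule nn_integral_FTC_Icc) (use assms in \<open>auto intro!: derivative_eq_intros\<close>)
  with assms show ?thesis by simp
qed

text \<open>Half-lines generate the Borel sets and are closed under intersection, so it is enough
  that both measures give \<open>{..r}\<close> the volume of the ball of radius r.\<close>

lemma distr_euclid_norm:
  assumes d: "d \<ge> 1"
  shows "distr (Rd d) borel (euclid_norm d)
    = density lborel (\<lambda>r. ennreal (unit_ball_vol d * d * r ^ (d - 1)) * indicator {0..} r)"
    (is "?M = ?N")
proof (rule measure_eqI_generator_eq[where E = "range atMost" and A = "\<lambda>n. {..real n}" and \<Omega> = UNIV])
  have M: "emeasure ?M {..r} = (if r \<ge> 0 then ennreal (unit_ball_vol d * r ^ d) else 0)" for r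
  proof -
    have "emeasure ?M {..r} = emeasure (Rd d) {x \<in> space (Rd d). euclid_norm d x \<le> r}"
      by (subst emeasure_distr) (auto intro!: arg_cong[where f = "emeasure (Rd d)"])
    also have "\<dots> = (if r \<ge> 0 then ennreal (unit_ball_vol d * r ^ d) else 0)"
    proof (cases r "0::real" rule: linorder_cases)
      case less
      then have "{x \<in> space (Rd d). euclid_norm d x \<le> r} = {}"
        using euclid_norm_nonneg[of d] by (force simp: not_le intro: less_le_trans)
      with less show ?thesis by (simp del: Collect_empty_eq)
    next
      \<comment> \<open>The ball formula covers positive radii only. At radius 0 the measure is
        squeezed by the volumes of shrinking balls, whose limit contains \<open>0 ^ d\<close> and
        vanishes because d is at least 1.\<close>
      case equal
      have "emeasure (Rd d) {x \<in> space (Rd d). euclid_norm d x \<le> 0} \<le> ennreal (unit_ball_vol d * e ^ d)"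
        if "e > 0" for e
        unfolding emeasure_ball_Rd[OF that, symmetric] using that
        by (intro emeasure_mono) auto
      moreover have "((\<lambda>e. ennreal (unit_ball_vol d * e ^ d)) \<longlongrightarrow> ennreal (unit_ball_vol d * 0 ^ d)) (at_right 0)"
        by (intro tendsto_intros)
      ultimately have "emeasure (Rd d) {x \<in> space (Rd d). euclid_norm d x \<le> 0} \<le> ennreal (unit_ball_vol d * 0 ^ d)"
        by (elim tendsto_lowerbound) (auto intro: eventually_mono[OF eventually_at_right_less])
      with equal d show ?thesis by (simp add: power_0_left)
    next
      case greater
      then show ?thesis using emeasure_ball_Rd by simp
    qed
    finally show ?thesis .
  qed
  have N: "emeasure ?N {..r} = (if r \<ge> 0 then ennreal (unit_ball_vol d * r ^ d) else 0)" for r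
  proof (cases "r \<ge> 0")
    case True
    have "emeasure ?N {..r} = (\<integral>\<^sup>+ x. ennreal (unit_ball_vol d) * (ennreal (d * x ^ (d - 1)) * indicator {0..r} x) \<partial>lborel)"
      by (subst emeasure_density)
        (auto intro!: nn_integral_cong simp: ennreal_mult[symmetric] mult_ac split: split_indicator)
    also have "\<dots> = ennreal (unit_ball_vol d * r ^ d)"
      using True nn_integral_power_Icc[OF True d] by (subst nn_integral_cmult) (auto simp: ennreal_mult)
    finally show ?thesis using True by simp
  next
    case False
    have "emeasure ?N {..r} = (\<integral>\<^sup>+ x. ennreal (unit_ball_vol d * d * x ^ (d - 1)) * indicator {0..} x * indicator {..r} x \<partial>lborel)"
      by (rule emeasure_density) auto
    also have "\<dots> = (\<integral>\<^sup>+ x. 0 \<partial>(lborel :: real measure))"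
      using False by (intro nn_integral_cong) (auto split: split_indicator)
    finally show ?thesis using False by simp
  qed
  show "emeasure ?M X = emeasure ?N X" if "X \<in> range atMost" for X
    using that M N by auto
  show "emeasure ?M {..real n} \<noteq> \<infinity>" for n
    by (simp add: M)
  show "Int_stable (range atMost :: real set set)"
    by (auto simp: Int_stable_def)
  show "sets ?M = sigma_sets UNIV (range atMost)" "sets ?N = sigma_sets UNIV (range atMost)"
    by (simp_all add: borel_eq_atMost)
  show "(\<Union>n. {..real n}) = UNIV"
    by (auto simp: real_arch_simple)
qed auto

lemma nn_integral_radial:
  assumes d: "d \<ge> 1" and [measurable]: "g \<in> borel_measurable borel"
  shows "(\<integral>\<^sup>+ x. g (euclid_norm d x) \<partial>Rd d)
    = ennreal (unit_ball_vol d * d) * (\<integral>\<^sup>+ r. g r * ennreal (r ^ (d - 1)) * indicator {0..} r \<partial>lborel)"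
proof -
  have "(\<integral>\<^sup>+ x. g (euclid_norm d x) \<partial>Rd d) = (\<integral>\<^sup>+ r. g r \<partial>distr (Rd d) borel (euclid_norm d))"
    by (subst nn_integral_distr) auto
  also have "\<dots> = (\<integral>\<^sup>+ r. ennreal (unit_ball_vol d * d * r ^ (d - 1)) * indicator {0..} r * g r \<partial>lborel)"
    unfolding distr_euclid_norm[OF d] by (subst nn_integral_density) auto
  also have "\<dots> = (\<integral>\<^sup>+ r. ennreal (unit_ball_vol d * d) * (g r * ennreal (r ^ (d - 1)) * indicator {0..} r) \<partial>lborel)"
    by (intro nn_integral_cong) (auto simp: ennreal_mult mult_ac split: split_indicator)
  also have "\<dots> = ennreal (unit_ball_vol d * d) * (\<integral>\<^sup>+ r. g r * ennreal (r ^ (d - 1)) * indicator {0..} r \<partial>lborel)"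
    by (subst nn_integral_cmult) auto
  finally show ?thesis .
qed

section \<open>Tails of Cauchy-type densities\<close>

text \<open>One family for both unnormalised densities: s = \<nu>, h = 1 is the target, s = 1, h =
  \<eta> the Cauchy step.\<close>

definition radial_weight :: "nat \<Rightarrow> real \<Rightarrow> real \<Rightarrow> real \<Rightarrow> real" where
  "radial_weight d s h r = (r\<^sup>2 + h\<^sup>2) powr (- (real d + s) / 2)"

lemma measurable_radial_weight [measurable]: "radial_weight d s h \<in> borel_measurable borel"
  unfolding radial_weight_def by measurable

lemma radial_weight_nonneg [simp]: "0 \<le> radial_weight d s h r"
  by (simp add: radial_weight_def)

lemma nn_integral_powr_atLeast:
  fixes a u :: real
  assumes "a > 0" "u > 0"
  shows "(\<integral>\<^sup>+ r. ennreal (r powr (- u - 1)) * indicator {a..} r \<partial>lborel) = ennreal (a powr (- u) / u)"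
proof -
  have "(\<integral>\<^sup>+ r. ennreal (r powr (- u - 1)) * indicator {a..} r \<partial>lborel)
      = ennreal (0 - (- (a powr (- u)) / u))"
  proof (rule nn_integral_FTC_atLeast)
    show "((\<lambda>r. - (r powr (- u)) / u) has_real_derivative x powr (- u - 1)) (at x)" if "a \<le> x" for x
      using that assms by (auto intro!: derivative_eq_intros simp: field_simps)
    show "((\<lambda>r. - (r powr (- u)) / u) \<longlongrightarrow> 0) at_top"
      using assms by real_asymp
  qed auto
  then show ?thesis by simp
qed

lemma nn_integral_powr_Icc_0:
  fixes b u :: real
  assumes "b \<ge> 0" "u < 1"
  shows "(\<integral>\<^sup>+ r. ennreal (r powr (- u)) * indicator {0..b} r \<partial>lborel) = ennreal (b powr (1 - u) / (1 - u))"
proof -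
  have "((\<lambda>r. r powr (- u)) has_integral (b powr (- u + 1) / (- u + 1))) {0..b}"
    using assms by (intro has_integral_powr_from_0) auto
  from nn_integral_has_integral_lebesgue'[OF _ this] show ?thesis
    by (simp add: add.commute)
qed

lemma power2_powr_half:
  fixes r u :: real
  assumes "r > 0"
  shows "(r\<^sup>2) powr (- u / 2) = r powr (- u)"
proof -
  have "r\<^sup>2 = r powr 2" using assms by simp
  then show ?thesis by (simp only: powr_powr) simp
qed

lemma power_pred_eq_powr:
  fixes r :: real
  assumes "r > 0" "d \<ge> 1"
  shows "r ^ (d - 1) = r powr (real d - 1)"
  using assms by (simp add: powr_realpow[symmetric] of_nat_diff)

lemma powr_weight_le:
  fixes r h u :: real
  assumes "r > 0" "u \<ge> 0"
  shows "(r\<^sup>2 + h\<^sup>2) powr (- u / 2) \<le> r powr (- u)"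
proof -
  have "(r\<^sup>2 + h\<^sup>2) powr (- u / 2) \<le> (r\<^sup>2) powr (- u / 2)"
    using assms by (intro powr_mono2') auto
  also have "\<dots> = r powr (- u)"
    using assms by (intro power2_powr_half)
  finally show ?thesis .
qed

text \<open>Omitting h leaves the radial integrand r^(t - s - 1), which is integrable at infinity
  for t < s. With t = 0 this bounds tail masses; with s = 1 and t = \<tau> it bounds the moment of a
  Cauchy step beyond radius a.\<close>

lemma weight_tail_upper:
  assumes "d \<ge> 1" "a > 0" "t < s" "s > 0"
  shows "(\<integral>\<^sup>+ x. ennreal (euclid_norm d x powr t * radial_weight d s h (euclid_norm d x))
            * indicator {a..} (euclid_norm d x) \<partial>Rd d)
    \<le> ennreal (unit_ball_vol d * d * (a powr (t - s) / (s - t)))"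
proof -
  have *: "r powr t * radial_weight d s h r * r ^ (d - 1) \<le> r powr (- (s - t) - 1)" if "r \<ge> a" for r
  proof -
    have r: "r > 0" using that assms by simp
    have "r powr t * radial_weight d s h r * r ^ (d - 1) \<le> r powr t * r powr (- (d + s)) * r ^ (d - 1)"
      unfolding radial_weight_def using r assms powr_weight_le[of r "d + s" h]
      by (intro mult_right_mono mult_left_mono) auto
    also have "r ^ (d - 1) = r powr (real d - 1)"
      using r assms by (intro power_pred_eq_powr) auto
    also have "r powr t * r powr (- (d + s)) * r powr (real d - 1) = r powr (- (s - t) - 1)"
      by (simp add: powr_add[symmetric] algebra_simps)
    finally show ?thesis
      by (simp only: power_pred_eq_powr[OF r assms(1)])
  qed
  have "(\<integral>\<^sup>+ x. ennreal (euclid_norm d x powr t * radial_weight d s h (euclid_norm d x))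
            * indicator {a..} (euclid_norm d x) \<partial>Rd d)
    = ennreal (unit_ball_vol d * d) * (\<integral>\<^sup>+ r. ennreal (r powr t * radial_weight d s h r)
            * indicator {a..} r * ennreal (r ^ (d - 1)) * indicator {0..} r \<partial>lborel)"
    by (intro nn_integral_radial) (use assms in auto)
  also have "\<dots> \<le> ennreal (unit_ball_vol d * d) * (\<integral>\<^sup>+ r. ennreal (r powr (- (s - t) - 1)) * indicator {a..} r \<partial>lborel)"
  proof (intro mult_left_mono nn_integral_mono)
    show "ennreal (r powr t * radial_weight d s h r) * indicator {a..} r * ennreal (r ^ (d - 1)) * indicator {0..} r
      \<le> ennreal (r powr (- (s - t) - 1)) * indicator {a..} r" for r
      using *[of r] by (auto simp: ennreal_mult'[symmetric] split: split_indicator)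
  qed auto
  also have "\<dots> = ennreal (unit_ball_vol d * d * (a powr (t - s) / (s - t)))"
    using assms by (subst nn_integral_powr_atLeast) (auto simp: ennreal_mult'[symmetric])
  finally show ?thesis .
qed

text \<open>For r \<ge> h sqrt d one has h^2 / r^2 \<le> 1 / d, so replacing r^2 by r^2 + h^2 costs
  at most a factor (1 + 1/d)^((d + s)/2) \<le> e, by s \<le> 1 \<le> d. This is the origin of the
  scale sqrt d.\<close>

lemma weight_tail_lower:
  assumes "d \<ge> 1" "0 < s" "s \<le> 1" "0 < h" "h * sqrt d \<le> a"
  shows "ennreal (unit_ball_vol d * d * (exp (- 1) * (a powr (- s) / s)))
    \<le> (\<integral>\<^sup>+ x. ennreal (radial_weight d s h (euclid_norm d x)) * indicator {a..} (euclid_norm d x) \<partial>Rd d)"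
proof -
  have a: "a > 0"
    using assms by (intro less_le_trans[OF _ assms(5)]) auto
  have *: "exp (- 1) * r powr (- s - 1) \<le> radial_weight d s h r * r ^ (d - 1)" if "r \<ge> a" for r
  proof -
    have r: "r > 0" using that a by simp
    have "h * sqrt d \<le> r" using that assms by simp
    then have "(h * sqrt d)\<^sup>2 \<le> r\<^sup>2" using assms by (intro power_mono) auto
    then have le: "h\<^sup>2 * d \<le> r\<^sup>2" by (simp add: power_mult_distrib)
    have "ln (1 + h\<^sup>2 / r\<^sup>2) \<le> h\<^sup>2 / r\<^sup>2"
      by (intro ln_add_one_self_le_self) auto
    also have "h\<^sup>2 / r\<^sup>2 \<le> 1 / d"
      using le r assms by (simp add: field_simps)
    finally have "(d + s) / 2 * ln (1 + h\<^sup>2 / r\<^sup>2) \<le> (d + s) / 2 * (1 / d)"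
      using assms by (intro mult_left_mono) auto
    also have "\<dots> \<le> 1"
      using assms by (simp add: field_simps)
    finally have "(d + s) / 2 * ln (1 + h\<^sup>2 / r\<^sup>2) \<le> 1" .
    moreover have "- (d + s) / 2 * L = - ((d + s) / 2 * L)" for L :: real
      by (simp add: field_simps)
    ultimately have ex: "exp (- 1) \<le> (1 + h\<^sup>2 / r\<^sup>2) powr (- (d + s) / 2)"
      using r by (simp add: powr_def add_pos_nonneg less_imp_neq[symmetric] del: minus_add_distrib)
    have "r\<^sup>2 * (1 + h\<^sup>2 / r\<^sup>2) = r\<^sup>2 + h\<^sup>2"
      using r by (simp add: field_simps)
    then have "radial_weight d s h r = (r\<^sup>2 * (1 + h\<^sup>2 / r\<^sup>2)) powr (- (d + s) / 2)"
      by (simp add: radial_weight_def)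
    also have "\<dots> = r powr (- (d + s)) * (1 + h\<^sup>2 / r\<^sup>2) powr (- (d + s) / 2)"
      using powr_mult[of "r\<^sup>2" "1 + h\<^sup>2 / r\<^sup>2"] power2_powr_half[OF r, of "d + s"] by simp
    finally have "r powr (- (d + s)) * exp (- 1) \<le> radial_weight d s h r"
      using ex by (simp add: mult_left_mono)
    then have "r powr (- (d + s)) * exp (- 1) * r ^ (d - 1) \<le> radial_weight d s h r * r ^ (d - 1)"
      using r by (intro mult_right_mono) auto
    also have "r ^ (d - 1) = r powr (real d - 1)"
      using r assms by (intro power_pred_eq_powr) auto
    also have "r powr (- (d + s)) * exp (- 1) * r powr (real d - 1) = exp (- 1) * r powr (- (d + s) + (real d - 1))"
      by (simp only: powr_add mult_ac)
    also have "- (d + s) + (real d - 1) = - s - 1" by simp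
    finally show ?thesis
      by (simp only: power_pred_eq_powr[OF r assms(1)])
  qed
  have "ennreal (unit_ball_vol d * d * (exp (- 1) * (a powr (- s) / s)))
     = ennreal (unit_ball_vol d * d) * (ennreal (exp (- 1)) * (\<integral>\<^sup>+ r. ennreal (r powr (- s - 1)) * indicator {a..} r \<partial>lborel))"
    using assms a by (subst nn_integral_powr_atLeast) (auto simp: ennreal_mult'[symmetric])
  also have "ennreal (exp (- 1)) * (\<integral>\<^sup>+ r. ennreal (r powr (- s - 1)) * indicator {a..} r \<partial>lborel)
     = (\<integral>\<^sup>+ r. ennreal (exp (- 1)) * (ennreal (r powr (- s - 1)) * indicator {a..} r) \<partial>lborel)"
    by (rule nn_integral_cmult[symmetric]) auto
  also have "ennreal (unit_ball_vol d * d) * \<dots> \<le> ennreal (unit_ball_vol d * d) *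
     (\<integral>\<^sup>+ r. ennreal (radial_weight d s h r) * indicator {a..} r * ennreal (r ^ (d - 1)) * indicator {0..} r \<partial>lborel)"
  proof (intro mult_left_mono nn_integral_mono)
    show "ennreal (exp (- 1)) * (ennreal (r powr (- s - 1)) * indicator {a..} r)
      \<le> ennreal (radial_weight d s h r) * indicator {a..} r * ennreal (r ^ (d - 1)) * indicator {0..} r" for r
      using *[of r] a by (auto simp: ennreal_mult'[symmetric] split: split_indicator)
  qed auto
  also have "\<dots> = (\<integral>\<^sup>+ x. ennreal (radial_weight d s h (euclid_norm d x)) * indicator {a..} (euclid_norm d x) \<partial>Rd d)"
    by (intro nn_integral_radial[symmetric]) (use assms in auto)
  finally show ?thesis .
qed

text \<open>
  By Bernoulli's inequality \<open>(1 + 1/r\<^sup>2)\<^sup>d \<ge> d/r\<^sup>2\<close>, which turns the integrand into \<open>r\<^bsup>-s\<^esup> / \<surd>d\<close> and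
  makes the bound uniform in d.
\<close>

lemma weight_ball_upper:
  assumes "d \<ge> 1" "0 < s" "s < 1"
  shows "(\<integral>\<^sup>+ x. ennreal (radial_weight d s 1 (euclid_norm d x)) * indicator {..<sqrt d} (euclid_norm d x) \<partial>Rd d)
    \<le> ennreal (unit_ball_vol d * d * (d powr (- s / 2) / (1 - s)))"
proof -
  have *: "radial_weight d s 1 r * r ^ (d - 1) \<le> r powr (- s) / sqrt d" if "r > 0" for r
  proof -
    have "1 + d * (1 / r\<^sup>2) \<le> (1 + 1 / r\<^sup>2) ^ d"
      by (intro Bernoulli_inequality) (auto intro: order_trans[of _ 0])
    then have "d / r\<^sup>2 \<le> (1 + 1 / r\<^sup>2) ^ d" by simp
    also have "(1 + 1 / r\<^sup>2) ^ d = (1 + 1 / r\<^sup>2) powr d"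
      using that by (simp add: powr_realpow add_pos_nonneg)
    finally have "((1 + 1 / r\<^sup>2) powr d) powr (- 1 / 2) \<le> (d / r\<^sup>2) powr (- 1 / 2)"
      using that assms by (intro powr_mono2') auto
    also have "(d / r\<^sup>2) powr (- 1 / 2) = r / sqrt d"
      using that assms by (simp add: powr_minus powr_half_sqrt real_sqrt_divide inverse_eq_divide)
    finally have b: "(1 + 1 / r\<^sup>2) powr (- real d / 2) \<le> r / sqrt d"
      by (simp add: powr_powr)
    have "radial_weight d s 1 r = (r\<^sup>2 + 1) powr (- s / 2) * (r\<^sup>2 * (1 + 1 / r\<^sup>2)) powr (- real d / 2)"
    proof -
      have "r\<^sup>2 * (1 + 1 / r\<^sup>2) = r\<^sup>2 + 1"
        using that by (simp add: field_simps)
      then show ?thesis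
        by (simp add: radial_weight_def powr_add[symmetric] add_divide_distrib diff_divide_distrib algebra_simps)
    qed
    also have "(r\<^sup>2 * (1 + 1 / r\<^sup>2)) powr (- real d / 2) = r powr (- real d) * (1 + 1 / r\<^sup>2) powr (- real d / 2)"
      using powr_mult[of "r\<^sup>2" "1 + 1 / r\<^sup>2"] power2_powr_half[OF that, of "real d"] by simp
    also have "(r\<^sup>2 + 1) powr (- s / 2) * (r powr (- real d) * (1 + 1 / r\<^sup>2) powr (- real d / 2))
      \<le> r powr (- s) * (r powr (- real d) * (r / sqrt d))"
      using powr_weight_le[OF that, of s 1] b assms that by (intro mult_mono) auto
    finally have "radial_weight d s 1 r * r ^ (d - 1) \<le> r powr (- s) * (r powr (- real d) * (r / sqrt d)) * r ^ (d - 1)"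
      using that by (intro mult_right_mono) auto
    also have "r ^ (d - 1) = r powr (real d - 1)"
      using that assms by (intro power_pred_eq_powr) auto
    also have "r powr (- s) * (r powr (- real d) * (r / sqrt d)) * r powr (real d - 1)
       = r powr (- s) * (r powr (- real d) * r powr 1 * r powr (real d - 1)) / sqrt d"
      using that by simp
    also have "r powr (- real d) * r powr 1 * r powr (real d - 1) = 1"
      using that by (simp only: powr_add[symmetric]) simp
    finally show ?thesis
      by (simp only: power_pred_eq_powr[OF that assms(1)] mult_1_right)
  qed
  have "(\<integral>\<^sup>+ x. ennreal (radial_weight d s 1 (euclid_norm d x)) * indicator {..<sqrt d} (euclid_norm d x) \<partial>Rd d)
    = ennreal (unit_ball_vol d * d) *
     (\<integral>\<^sup>+ r. ennreal (radial_weight d s 1 r) * indicator {..<sqrt d} r * ennreal (r ^ (d - 1)) * indicator {0..} r \<partial>lborel)"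
    by (intro nn_integral_radial) (use assms in auto)
  also have "\<dots> \<le> ennreal (unit_ball_vol d * d) *
      (\<integral>\<^sup>+ r. ennreal (1 / sqrt d) * (ennreal (r powr (- s)) * indicator {0..sqrt d} r) \<partial>lborel)"
  proof (intro mult_left_mono nn_integral_mono_AE)
    \<comment> \<open>The point 0 has to be removed: there \<open>r powr (- s)\<close> is 0 by
      convention, while for d = 1 the left side is positive.\<close>
    have "AE r in lborel. r \<noteq> (0::real)"
      by (rule AE_lborel_singleton)
    then show "AE r in lborel. ennreal (radial_weight d s 1 r) * indicator {..<sqrt d} r * ennreal (r ^ (d - 1)) * indicator {0..} r
      \<le> ennreal (1 / sqrt d) * (ennreal (r powr (- s)) * indicator {0..sqrt d} r)"
    proof eventually_elim
      case (elim r)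
      then show ?case
        using *[of r] by (auto simp: ennreal_mult'[symmetric] split: split_indicator)
    qed
  qed auto
  also have "(\<integral>\<^sup>+ r. ennreal (1 / sqrt d) * (ennreal (r powr (- s)) * indicator {0..sqrt d} r) \<partial>lborel)
    = ennreal (1 / sqrt d * (sqrt d powr (1 - s) / (1 - s)))"
    using assms by (subst nn_integral_cmult) (auto simp: nn_integral_powr_Icc_0 ennreal_mult'[symmetric])
  also have "1 / sqrt d * (sqrt d powr (1 - s) / (1 - s)) = d powr (- s / 2) / (1 - s)"
    using assms by (simp add: powr_half_sqrt[symmetric] powr_powr powr_diff[symmetric] diff_divide_distrib)
  finally show ?thesis
    using assms by (simp add: ennreal_mult'[symmetric])
qed

text \<open>On the unit ball the weight is at most its value at 0; outside,
  \<open>weight_tail_upper\<close> applies with t = 0. The factor \<open>powr 0\<close> serves to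
  match that lemma and equals 1 there, the norm being at least 1.\<close>

lemma weight_total_finite:
  assumes "d \<ge> 1" "0 < s" "0 < h"
  shows "(\<integral>\<^sup>+ x. ennreal (radial_weight d s h (euclid_norm d x)) \<partial>Rd d) < \<infinity>"
proof -
  have le: "radial_weight d s h r \<le> (h\<^sup>2) powr (- (d + s) / 2)" for r
    unfolding radial_weight_def using assms by (intro powr_mono2') auto
  have "(\<integral>\<^sup>+ x. ennreal (radial_weight d s h (euclid_norm d x)) \<partial>Rd d)
    \<le> (\<integral>\<^sup>+ x. ennreal ((h\<^sup>2) powr (- (d + s) / 2)) * indicator {x \<in> space (Rd d). euclid_norm d x \<le> 1} x
       + ennreal (euclid_norm d x powr 0 * radial_weight d s h (euclid_norm d x)) * indicator {1..} (euclid_norm d x) \<partial>Rd d)"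
  proof (intro nn_integral_mono)
    fix x assume "x \<in> space (Rd d)"
    then show "ennreal (radial_weight d s h (euclid_norm d x)) \<le>
       ennreal ((h\<^sup>2) powr (- (d + s) / 2)) * indicator {x \<in> space (Rd d). euclid_norm d x \<le> 1} x
       + ennreal (euclid_norm d x powr 0 * radial_weight d s h (euclid_norm d x)) * indicator {1..} (euclid_norm d x)"
      using le[of "euclid_norm d x"] by (auto split: split_indicator intro!: ennreal_leI)
  qed
  also have "\<dots> = ennreal ((h\<^sup>2) powr (- (d + s) / 2)) * emeasure (Rd d) {x \<in> space (Rd d). euclid_norm d x \<le> 1}
     + (\<integral>\<^sup>+ x. ennreal (euclid_norm d x powr 0 * radial_weight d s h (euclid_norm d x)) * indicator {1..} (euclid_norm d x) \<partial>Rd d)"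
    by (subst nn_integral_add, measurable) (subst nn_integral_cmult_indicator, measurable)
  also have "\<dots> \<le> ennreal ((h\<^sup>2) powr (- (d + s) / 2)) * emeasure (Rd d) {x \<in> space (Rd d). euclid_norm d x \<le> 1}
     + ennreal (unit_ball_vol d * d * (1 powr (0 - s) / (s - 0)))"
    using assms by (intro add_left_mono weight_tail_upper) auto
  also have "\<dots> < \<infinity>"
    using emeasure_ball_Rd[of 1 d] by (simp add: ennreal_mult'[symmetric])
  finally show ?thesis .
qed

section \<open>Growth of moments along the sampler\<close>

text \<open>After division by a + b both summands lie in [0, 1], where u \<le> u^p for p \<le> 1,
  and they add up to 1.\<close>

lemma powr_add_le_add_powr:
  fixes a b p :: real
  assumes "0 \<le> a" "0 \<le> b" "0 < p" "p \<le> 1"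
  shows "(a + b) powr p \<le> a powr p + b powr p"
proof (cases "a + b = 0")
  case False
  with assms have pos: "a + b > 0" by linarith
  have le: "x / (a + b) \<le> x powr p / (a + b) powr p" if "0 \<le> x" "x \<le> a + b" for x
  proof -
    have "(x / (a + b)) powr 1 \<le> (x / (a + b)) powr p"
      using that pos assms by (intro powr_mono') auto
    with that pos show ?thesis by (simp add: powr_divide)
  qed
  have "1 = a / (a + b) + b / (a + b)"
    using pos by (simp add: add_divide_distrib[symmetric])
  also have "\<dots> \<le> a powr p / (a + b) powr p + b powr p / (a + b) powr p"
    using assms by (intro add_mono le) auto
  finally show ?thesis
    using pos by (simp add: add_divide_distrib[symmetric] field_simps)
qed (use assms in auto)

section \<open>Normalised densities, kernels given by densities, and the association
  inequality\<close>

lemma nn_integral_normalize_pdf: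
  assumes "f \<in> borel_measurable M" "(\<integral>\<^sup>+ x. f x \<partial>M) \<noteq> 0" "(\<integral>\<^sup>+ x. f x \<partial>M) < \<infinity>"
  shows "(\<integral>\<^sup>+ x. normalize_pdf M f x \<partial>M) = 1"
  using assms unfolding normalize_pdf_def by (subst nn_integral_divide) auto

lemma borel_measurable_normalize_pdf [measurable (raw)]:
  "f \<in> borel_measurable M \<Longrightarrow> normalize_pdf M f \<in> borel_measurable M"
  unfolding normalize_pdf_def[abs_def] divide_ennreal_def by (intro borel_measurable_times_ennreal) auto

lemma prob_space_densityI:
  assumes "f \<in> borel_measurable M" "(\<integral>\<^sup>+ x. f x \<partial>M) = 1"
  shows "prob_space (density M f)"
  using assms by (intro prob_spaceI) (simp add: emeasure_density cong: nn_integral_cong)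

text \<open>By joint measurability and Tonelli the mass of a fixed set depends measurably on the
  parameter. Both sampler kernels are of this form, and this makes their composition by bind
  legitimate.\<close>

lemma measurable_density_kernel:
  assumes M: "sigma_finite_measure M"
    and f[measurable]: "case_prod f \<in> borel_measurable (N \<Otimes>\<^sub>M M)"
    and one: "\<And>x. x \<in> space N \<Longrightarrow> (\<integral>\<^sup>+ y. f x y \<partial>M) = 1"
  shows "(\<lambda>x. density M (f x)) \<in> measurable N (prob_algebra M)"
proof (rule measurable_prob_algebraI)
  interpret sigma_finite_measure M by (rule M)
  have fx: "f x \<in> borel_measurable M" if "x \<in> space N" for x
    using measurable_Pair2[OF f that] by simp
  show *: "prob_space (density M (f x))" if "x \<in> space N" for x
    using that fx one by (intro prob_space_densityI)
  show "(\<lambda>x. density M (f x)) \<in> measurable N (subprob_algebra M)"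
  proof (rule measurable_subprob_algebra)
    fix A assume A[measurable]: "A \<in> sets M"
    have "(\<lambda>x. \<integral>\<^sup>+ y. f x y * indicator A y \<partial>M) \<in> borel_measurable N"
      by measurable
    then show "(\<lambda>x. emeasure (density M (f x)) A) \<in> borel_measurable N"
      using fx A by (subst measurable_cong[OF emeasure_density]) auto
  qed (use * prob_space_imp_subprob_space in auto)
qed

text \<open>
  With \<open>m\<close> the mean of f and \<open>c\<close> the threshold value of g where f exceeds \<open>m\<close>, integrate
  \<open>(f - m) (g - c) \<le> 0\<close>, rearranged so that no subtraction in \<^typ>\<open>ennreal\<close> occurs.
\<close>

lemma nn_integral_mult_le_antimonotone:
  fixes f g w :: "'a \<Rightarrow> ennreal"
  assumes [measurable]: "f \<in> borel_measurable M" "g \<in> borel_measurable M" "w \<in> borel_measurable M"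
    and w: "(\<integral>\<^sup>+ x. w x \<partial>M) = 1"
    and fin: "(\<integral>\<^sup>+ x. f x * w x \<partial>M) < \<infinity>"
    and g: "\<And>x. g x \<le> B" "B < \<infinity>"
    and anti: "\<And>x y. f x < f y \<Longrightarrow> g y \<le> g x"
  shows "(\<integral>\<^sup>+ x. f x * (g x * w x) \<partial>M) \<le> (\<integral>\<^sup>+ x. f x * w x \<partial>M) * (\<integral>\<^sup>+ x. g x * w x \<partial>M)"
proof -
  define m where "m = (\<integral>\<^sup>+ x. f x * w x \<partial>M)"
  define c where "c = (SUP x\<in>{x. m < f x}. g x)"
  \<comment> \<open>Boundedness of g is what makes \<open>m * c\<close> finite, so that it can be
    cancelled in \<open>ennreal\<close> at the end.\<close>
  have "c \<le> B" unfolding c_def using g by (intro SUP_least) auto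
  with g fin have mc: "m * c < \<infinity>"
    by (auto simp: m_def ennreal_mult_less_top intro: le_less_trans)
  have le: "f x * g x + m * c \<le> m * g x + f x * c" for x
  proof (cases "f x \<le> m")
    case True
    then have "c \<le> g x"
      unfolding c_def using anti by (intro SUP_least) (auto intro: le_less_trans)
    \<comment> \<open>With the gaps named e and k, the right side exceeds the left by exactly
      \<open>e * k\<close>; the other case is the same with both gaps reversed.\<close>
    with True obtain e k where "m = f x + e" "g x = c + k"
      by (auto simp: le_iff_add)
    then show ?thesis by (simp add: distrib_left distrib_right add_ac)
  next
    case False
    then have "g x \<le> c" "m \<le> f x"
      unfolding c_def by (auto intro: SUP_upper)
    then obtain e k where "f x = m + e" "c = g x + k"
      by (auto simp: le_iff_add)
    then show ?thesis by (simp add: distrib_left distrib_right add_ac)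
  qed
  have "m * c + (\<integral>\<^sup>+ x. f x * (g x * w x) \<partial>M) = (\<integral>\<^sup>+ x. m * c * w x + f x * (g x * w x) \<partial>M)"
    using w by (subst nn_integral_add) (auto simp: nn_integral_cmult)
  also have "\<dots> \<le> (\<integral>\<^sup>+ x. c * (f x * w x) + m * (g x * w x) \<partial>M)"
  proof (rule nn_integral_mono)
    show "m * c * w x + f x * (g x * w x) \<le> c * (f x * w x) + m * (g x * w x)" for x
      using mult_right_mono[OF le[of x], of "w x"] by (simp add: distrib_left distrib_right mult_ac add_ac)
  qed
  also have "\<dots> = m * c + m * (\<integral>\<^sup>+ x. g x * w x \<partial>M)"
    by (subst nn_integral_add) (auto simp: nn_integral_cmult m_def[symmetric] mult.commute[of c m])
  finally show ?thesis
    using mc by (auto simp: ennreal_add_left_cancel_le m_def)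
qed

lemma AE_Rd_nontrivial: "\<not> (AE x in Rd d. False)"
proof
  assume "AE x in Rd d. False"
  then have "emeasure (Rd d) {x \<in> space (Rd d). euclid_norm d x \<le> 1} = 0"
    by (intro emeasure_eq_0_AE) auto
  moreover have "ennreal (unit_ball_vol d) \<noteq> 0"
    using unit_ball_vol_pos[of "real d"] by (metis ennreal_eq_0_iff not_le of_nat_0_le_iff)
  ultimately show False
    using emeasure_ball_Rd[of 1 d] by simp
qed

lemma nn_integral_Rd_pos:
  assumes [measurable]: "f \<in> borel_measurable (Rd d)" and "\<And>x. x \<in> space (Rd d) \<Longrightarrow> f x > 0"
  shows "(\<integral>\<^sup>+ x. f x \<partial>Rd d) \<noteq> 0"
proof
  assume "(\<integral>\<^sup>+ x. f x \<partial>Rd d) = 0"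
  then have "AE x in Rd d. f x = 0" by (subst (asm) nn_integral_0_iff_AE) auto
  moreover have "AE x in Rd d. f x > 0" using assms by (intro AE_I2) auto
  ultimately have "AE x in Rd d. False" by eventually_elim auto
  then show False using AE_Rd_nontrivial by blast
qed

section \<open>The densities of target and step as normalised radial weights\<close>

lemma radial_weight_pos: "(h::real) > 0 \<Longrightarrow> radial_weight d s h r > 0"
  unfolding radial_weight_def by (simp add: add_nonneg_pos less_imp_neq[symmetric])

lemma radial_weight_antimono:
  fixes s :: real
  assumes "0 \<le> r" "r \<le> r'" "h > 0" "d + s \<ge> 0"
  shows "radial_weight d s h r' \<le> radial_weight d s h r"
  unfolding radial_weight_def using assms
  by (intro powr_mono2') (auto intro!: power_mono add_nonneg_pos)

lemma weight_total_nonzero: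
  "h > 0 \<Longrightarrow> (\<integral>\<^sup>+ x. ennreal (radial_weight d s h (euclid_norm d x)) \<partial>Rd d) \<noteq> 0"
  by (intro nn_integral_Rd_pos) (auto simp: radial_weight_pos)

lemma cauchy_pdf_eq:
  "cauchy_pdf d \<eta> = normalize_pdf (Rd d) (\<lambda>z. ennreal (radial_weight d 1 \<eta> (euclid_norm d z)))"
  unfolding cauchy_pdf_def radial_weight_def ..

lemma target_pdf_eq:
  "target_pdf d \<nu> = normalize_pdf (Rd d) (\<lambda>z. ennreal (radial_weight d \<nu> 1 (euclid_norm d z)))"
proof -
  have "exp (- potential d \<nu> x) = radial_weight d \<nu> 1 (euclid_norm d x)" for x
  proof -
    have "1 + (euclid_norm d x)\<^sup>2 \<noteq> 0"
      using add_pos_nonneg[of 1 "(euclid_norm d x)\<^sup>2"] by simp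
    moreover have "(euclid_norm d x)\<^sup>2 + 1\<^sup>2 = 1 + (euclid_norm d x)\<^sup>2" by simp
    moreover have "- (real d + \<nu>) / 2 * L = - ((real d + \<nu>) / 2 * L)" for L :: real
      by (simp only: mult_minus_left minus_divide_left)
    ultimately show ?thesis
      by (simp only: potential_def radial_weight_def powr_def if_False)
  qed
  then show ?thesis by (simp add: target_pdf_def)
qed

lemma measurable_cauchy_pdf [measurable]: "cauchy_pdf d \<eta> \<in> borel_measurable (Rd d)"
  unfolding cauchy_pdf_eq by measurable

lemma measurable_target_pdf [measurable]: "target_pdf d \<nu> \<in> borel_measurable (Rd d)"
  unfolding target_pdf_eq by measurable

lemma transition_pdf_eq: "transition_pdf d \<eta> x y = cauchy_pdf d \<eta> (diff_Rd d y x)"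
  unfolding transition_pdf_def diff_Rd_def ..

text \<open>The step density is even. As a function of x the backward density is therefore that of a
  fresh Cauchy step from y, reweighted by the target.\<close>

lemma transition_pdf_commute: "transition_pdf d \<eta> x y = transition_pdf d \<eta> y x"
  unfolding transition_pdf_eq cauchy_pdf_eq normalize_pdf_def
  by (simp add: euclid_norm_diff_Rd_commute)

lemma measurable_transition_pdf [measurable (raw)]:
  assumes [measurable]: "f \<in> measurable M (Rd d)" "g \<in> measurable M (Rd d)"
  shows "(\<lambda>z. transition_pdf d \<eta> (f z) (g z)) \<in> borel_measurable M"
  unfolding transition_pdf_eq by measurable

text \<open>Split at the natural scale a = \<eta> sqrt d. The inner part contributes at most
  a^\<tau>. For the outer part, the upper tail bound is divided by the lower tail bound at the same
  a, used as a lower bound for the normaliser; the quotient is a^\<tau> e / (1 - \<tau>).\<close>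

lemma cauchy_moment:
  assumes d: "d \<ge> 1" and \<eta>: "\<eta> > 0" and \<tau>: "0 < \<tau>" "\<tau> < 1"
  shows "(\<integral>\<^sup>+ z. ennreal (euclid_norm d z powr \<tau>) * cauchy_pdf d \<eta> z \<partial>Rd d)
    \<le> ennreal ((\<eta> * sqrt d) powr \<tau> * (1 + exp 1 / (1 - \<tau>)))"
proof -
  define a where "a = \<eta> * sqrt d"
  have a: "a > 0" using d \<eta> by (simp add: a_def)
  let ?w = "\<lambda>z. radial_weight d 1 \<eta> (euclid_norm d z)"
  define Z where "Z = (\<integral>\<^sup>+ z. ennreal (?w z) \<partial>Rd d)"
  have Z: "Z \<noteq> 0" "Z < \<infinity>"
    using weight_total_finite[of d 1 \<eta>] weight_total_nonzero[of \<eta> d 1] d \<eta> by (auto simp: Z_def)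
  have Zlow: "ennreal (unit_ball_vol d * d * (exp (- 1) * (a powr (- 1) / 1))) \<le> Z"
  proof -
    have "ennreal (unit_ball_vol d * d * (exp (- 1) * (a powr (- 1) / 1)))
       \<le> (\<integral>\<^sup>+ x. ennreal (?w x) * indicator {a..} (euclid_norm d x) \<partial>Rd d)"
      using d \<eta> by (intro weight_tail_lower) (auto simp: a_def)
    also have "\<dots> \<le> Z"
      unfolding Z_def by (intro nn_integral_mono) (auto split: split_indicator)
    finally show ?thesis .
  qed
  \<comment> \<open>The outer moment is rewritten as a multiple of the lower bound for Z; here the
    factor d times the unit ball volume drops out.\<close>
  have scale: "ennreal (unit_ball_vol d * d * (a powr (\<tau> - 1) / (1 - \<tau>)))
     = ennreal (a powr \<tau> * exp 1 / (1 - \<tau>)) * ennreal (unit_ball_vol d * d * (exp (- 1) * (a powr (- 1) / 1)))"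
  proof -
    have "a powr \<tau> * exp 1 / (1 - \<tau>) * (unit_ball_vol d * d * (exp (- 1) * (a powr (- 1) / 1)))
       = unit_ball_vol d * d * ((a powr \<tau> * a powr (- 1)) * (exp 1 * exp (- 1)) / (1 - \<tau>))"
      by (simp only: divide_inverse mult_ac inverse_1 mult_1_right mult_1_left)
    also have "a powr \<tau> * a powr (- 1) = a powr (\<tau> - 1)"
      by (simp only: powr_add[symmetric]) simp
    finally show ?thesis
      using \<tau> by (simp add: ennreal_mult'[symmetric] exp_minus)
  qed
  have "(\<integral>\<^sup>+ z. ennreal (euclid_norm d z powr \<tau> * ?w z) \<partial>Rd d)
     \<le> (\<integral>\<^sup>+ z. ennreal (a powr \<tau>) * ennreal (?w z)
          + ennreal (euclid_norm d z powr \<tau> * ?w z) * indicator {a..} (euclid_norm d z) \<partial>Rd d)"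
  proof (intro nn_integral_mono)
    fix z
    have "euclid_norm d z powr \<tau> * ?w z \<le> a powr \<tau> * ?w z" if "euclid_norm d z \<le> a"
      using that \<tau> by (intro mult_right_mono powr_mono2) auto
    then show "ennreal (euclid_norm d z powr \<tau> * ?w z) \<le> ennreal (a powr \<tau>) * ennreal (?w z)
          + ennreal (euclid_norm d z powr \<tau> * ?w z) * indicator {a..} (euclid_norm d z)"
      by (auto simp: ennreal_mult'[symmetric] split: split_indicator intro!: ennreal_leI)
  qed
  also have "\<dots> = ennreal (a powr \<tau>) * Z
      + (\<integral>\<^sup>+ z. ennreal (euclid_norm d z powr \<tau> * ?w z) * indicator {a..} (euclid_norm d z) \<partial>Rd d)"
    unfolding Z_def by (subst nn_integral_add) (auto simp: nn_integral_cmult)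
  also have "\<dots> \<le> ennreal (a powr \<tau>) * Z + ennreal (unit_ball_vol d * d * (a powr (\<tau> - 1) / (1 - \<tau>)))"
    using d a \<tau> by (intro add_left_mono weight_tail_upper) auto
  also have "\<dots> \<le> ennreal (a powr \<tau>) * Z + ennreal (a powr \<tau> * exp 1 / (1 - \<tau>)) * Z"
    unfolding scale by (intro add_left_mono mult_left_mono Zlow) auto
  also have "\<dots> = ennreal (a powr \<tau> * (1 + exp 1 / (1 - \<tau>))) * Z"
    unfolding distrib_right[symmetric] using \<tau>
    by (subst ennreal_plus[symmetric]) (auto simp: distrib_left)
  finally have le: "(\<integral>\<^sup>+ z. ennreal (euclid_norm d z powr \<tau> * ?w z) \<partial>Rd d)
    \<le> ennreal (a powr \<tau> * (1 + exp 1 / (1 - \<tau>))) * Z" .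
  have "(\<integral>\<^sup>+ z. ennreal (euclid_norm d z powr \<tau>) * cauchy_pdf d \<eta> z \<partial>Rd d)
     = (\<integral>\<^sup>+ z. (ennreal (euclid_norm d z powr \<tau> * ?w z)) / Z \<partial>Rd d)"
    unfolding cauchy_pdf_eq normalize_pdf_def Z_def
    by (intro nn_integral_cong) (simp add: ennreal_times_divide ennreal_mult)
  also have "\<dots> = (\<integral>\<^sup>+ z. ennreal (euclid_norm d z powr \<tau> * ?w z) \<partial>Rd d) / Z"
    by (rule nn_integral_divide) auto
  also have "\<dots> \<le> ennreal (a powr \<tau> * (1 + exp 1 / (1 - \<tau>))) * Z / Z"
    by (rule divide_right_mono_ennreal[OF le])
  also have "\<dots> = ennreal (a powr \<tau> * (1 + exp 1 / (1 - \<tau>)))"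
    using Z by (simp add: ennreal_mult_divide_eq)
  finally show ?thesis
    by (simp add: a_def)
qed

section \<open>The moment recursion for a radially decreasing target\<close>

definition norm_moment :: "nat \<Rightarrow> real \<Rightarrow> (nat \<Rightarrow> real) measure \<Rightarrow> ennreal" where
  "norm_moment d \<tau> \<rho> = (\<integral>\<^sup>+ x. ennreal (euclid_norm d x powr \<tau>) \<partial>\<rho>)"

text \<open>Exactly the features of the target that the recursion uses. The bound \<open>B\<close>
  keeps the backward normaliser finite and feeds the cancellation in the association inequality;
  monotonicity in the norm supplies its order hypothesis.\<close>

locale radial_sampler =
  fixes d :: nat and \<eta> :: real and \<pi> :: "(nat \<Rightarrow> real) \<Rightarrow> ennreal" and B :: ennreal
  assumes d: "1 \<le> d" and \<eta>: "0 < \<eta>"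
    and \<pi>_measurable [measurable]: "\<pi> \<in> borel_measurable (Rd d)"
    and \<pi>_pos: "\<And>x. 0 < \<pi> x"
    and \<pi>_le: "\<And>x. \<pi> x \<le> B" "B < \<infinity>"
    and \<pi>_antimono: "\<And>x y. euclid_norm d x \<le> euclid_norm d y \<Longrightarrow> \<pi> y \<le> \<pi> x"
begin

lemma nn_integral_cauchy_pdf: "(\<integral>\<^sup>+ z. cauchy_pdf d \<eta> z \<partial>Rd d) = 1"
  unfolding cauchy_pdf_eq
  using d \<eta> weight_total_nonzero[of \<eta> d 1] weight_total_finite[of d 1 \<eta>]
  by (intro nn_integral_normalize_pdf) auto

lemma cauchy_pdf_pos: "0 < cauchy_pdf d \<eta> z"
  using d \<eta> weight_total_finite[of d 1 \<eta>]
  by (simp add: cauchy_pdf_eq normalize_pdf_def ennreal_zero_less_divide radial_weight_pos)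

lemma transition_pdf_eq': "transition_pdf d \<eta> x y = cauchy_pdf d \<eta> (diff_Rd d x y)"
  by (subst transition_pdf_commute) (rule transition_pdf_eq)

lemma nn_integral_transition_pdf:
  assumes "x \<in> space (Rd d)"
  shows "(\<integral>\<^sup>+ y. transition_pdf d \<eta> x y \<partial>Rd d) = 1"
  unfolding transition_pdf_eq' using assms
  by (subst nn_integral_diff_Rd) (auto simp: nn_integral_cauchy_pdf)

lemma forward_kernel_measurable: "forward_kernel d \<eta> \<in> measurable (Rd d) (prob_algebra (Rd d))"
  unfolding forward_kernel_def[abs_def]
  by (intro measurable_density_kernel sigma_finite_Rd nn_integral_transition_pdf)
    (simp add: split_beta')

lemma backward_normaliser:
  assumes y: "y \<in> space (Rd d)"
  shows "(\<integral>\<^sup>+ x. \<pi> x * transition_pdf d \<eta> x y \<partial>Rd d) \<noteq> 0"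
    and "(\<integral>\<^sup>+ x. \<pi> x * transition_pdf d \<eta> x y \<partial>Rd d) < \<infinity>"
proof -
  show "(\<integral>\<^sup>+ x. \<pi> x * transition_pdf d \<eta> x y \<partial>Rd d) \<noteq> 0"
    using y \<pi>_pos cauchy_pdf_pos
    by (intro nn_integral_Rd_pos) (auto simp: transition_pdf_eq ennreal_zero_less_mult_iff)
  have "(\<integral>\<^sup>+ x. \<pi> x * transition_pdf d \<eta> x y \<partial>Rd d) \<le> (\<integral>\<^sup>+ x. B * transition_pdf d \<eta> x y \<partial>Rd d)"
    using \<pi>_le by (intro nn_integral_mono mult_right_mono) auto
  also have "\<dots> = B * (\<integral>\<^sup>+ x. transition_pdf d \<eta> y x \<partial>Rd d)"
    using y by (simp add: transition_pdf_commute[of d \<eta> _ y] nn_integral_cmult)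
  also have "\<dots> < \<infinity>"
    using y \<pi>_le by (simp add: nn_integral_transition_pdf)
  finally show "(\<integral>\<^sup>+ x. \<pi> x * transition_pdf d \<eta> x y \<partial>Rd d) < \<infinity>" .
qed

lemma backward_kernel_measurable: "backward_kernel d \<pi> \<eta> \<in> measurable (Rd d) (prob_algebra (Rd d))"
  unfolding backward_kernel_def[abs_def]
proof (intro measurable_density_kernel sigma_finite_Rd)
  interpret sigma_finite_measure "Rd d" by (rule sigma_finite_Rd)
  show "(\<lambda>(y, x). normalize_pdf (Rd d) (\<lambda>x. \<pi> x * transition_pdf d \<eta> x y) x)
      \<in> borel_measurable (Rd d \<Otimes>\<^sub>M Rd d)"
    unfolding normalize_pdf_def by measurable
  show "(\<integral>\<^sup>+ x. normalize_pdf (Rd d) (\<lambda>x. \<pi> x * transition_pdf d \<eta> x y) x \<partial>Rd d) = 1"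
    if "y \<in> space (Rd d)" for y
    using that backward_normaliser[OF that] by (intro nn_integral_normalize_pdf) auto
qed

context
  fixes \<tau> :: real
  assumes \<tau>: "0 < \<tau>" "\<tau> < 1"
begin

definition step_moment :: real where
  "step_moment = (\<eta> * sqrt d) powr \<tau> * (1 + exp 1 / (1 - \<tau>))"

lemma step_moment_nonneg: "0 \<le> step_moment"
  using \<tau> by (simp add: step_moment_def)

text \<open>Subadditivity of t^\<tau> separates the start x from the displacement, and the
  reflection y -> x - y turns the displacement into a centred Cauchy vector. By symmetry of the
  density this also serves the backward step, with y as the start.\<close>

lemma transition_moment:
  assumes x: "x \<in> space (Rd d)"
  shows "(\<integral>\<^sup>+ y. ennreal (euclid_norm d y powr \<tau>) * transition_pdf d \<eta> x y \<partial>Rd d)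
    \<le> ennreal (euclid_norm d x powr \<tau>) + ennreal step_moment"
proof -
  have "(\<integral>\<^sup>+ y. ennreal (euclid_norm d y powr \<tau>) * transition_pdf d \<eta> x y \<partial>Rd d)
    \<le> (\<integral>\<^sup>+ y. (ennreal (euclid_norm d x powr \<tau>) + ennreal (euclid_norm d (diff_Rd d x y) powr \<tau>))
         * cauchy_pdf d \<eta> (diff_Rd d x y) \<partial>Rd d)"
  proof (intro nn_integral_mono)
    fix y
    have "euclid_norm d y powr \<tau> \<le> (euclid_norm d x + euclid_norm d (diff_Rd d x y)) powr \<tau>"
      using \<tau> by (intro powr_mono2 euclid_norm_triangle) auto
    also have "\<dots> \<le> euclid_norm d x powr \<tau> + euclid_norm d (diff_Rd d x y) powr \<tau>"
      using \<tau> by (intro powr_add_le_add_powr) auto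
    finally show "ennreal (euclid_norm d y powr \<tau>) * transition_pdf d \<eta> x y
      \<le> (ennreal (euclid_norm d x powr \<tau>) + ennreal (euclid_norm d (diff_Rd d x y) powr \<tau>))
         * cauchy_pdf d \<eta> (diff_Rd d x y)"
      unfolding transition_pdf_eq'
      by (intro mult_right_mono) (auto simp: ennreal_plus[symmetric] simp del: ennreal_plus)
  qed
  also have "\<dots> = (\<integral>\<^sup>+ z. (ennreal (euclid_norm d x powr \<tau>) + ennreal (euclid_norm d z powr \<tau>))
         * cauchy_pdf d \<eta> z \<partial>Rd d)"
    using x by (intro nn_integral_diff_Rd) auto
  also have "\<dots> = ennreal (euclid_norm d x powr \<tau>)
      + (\<integral>\<^sup>+ z. ennreal (euclid_norm d z powr \<tau>) * cauchy_pdf d \<eta> z \<partial>Rd d)"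
    by (simp add: distrib_right nn_integral_add nn_integral_cmult nn_integral_cauchy_pdf)
  also have "\<dots> \<le> ennreal (euclid_norm d x powr \<tau>) + ennreal step_moment"
    unfolding step_moment_def using d \<eta> \<tau> by (intro add_left_mono cauchy_moment)
  finally show ?thesis .
qed

lemma forward_moment:
  assumes "x \<in> space (Rd d)"
  shows "norm_moment d \<tau> (forward_kernel d \<eta> x) \<le> ennreal (euclid_norm d x powr \<tau>) + ennreal step_moment"
proof -
  have "norm_moment d \<tau> (forward_kernel d \<eta> x)
     = (\<integral>\<^sup>+ y. ennreal (euclid_norm d y powr \<tau>) * transition_pdf d \<eta> x y \<partial>Rd d)"
    unfolding norm_moment_def forward_kernel_def using assms
    by (subst nn_integral_density) (auto simp: mult.commute)
  with transition_moment[OF assms] show ?thesis by simp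
qed

text \<open>The association inequality is applied with f = |x|^\<tau>, g = \<open>\<pi>\<close> and
  w the step density around y, which has mass 1 in x by symmetry. Dividing by Z, the integral of g
  w, shows that reweighting by \<open>\<pi>\<close> does not raise the mean of f.\<close>

lemma backward_moment:
  assumes y: "y \<in> space (Rd d)"
  shows "norm_moment d \<tau> (backward_kernel d \<pi> \<eta> y) \<le> ennreal (euclid_norm d y powr \<tau>) + ennreal step_moment"
proof -
  let ?f = "\<lambda>x. ennreal (euclid_norm d x powr \<tau>)"
  let ?w = "\<lambda>x. transition_pdf d \<eta> x y"
  define Z where "Z = (\<integral>\<^sup>+ x. \<pi> x * ?w x \<partial>Rd d)"
  have Z: "Z \<noteq> 0" "Z < \<infinity>"
    using backward_normaliser[OF y] by (simp_all add: Z_def)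
  have w: "(\<integral>\<^sup>+ x. ?w x \<partial>Rd d) = 1"
    using nn_integral_transition_pdf[OF y] by (simp add: transition_pdf_commute[of d \<eta> _ y])
  have fw: "(\<integral>\<^sup>+ x. ?f x * ?w x \<partial>Rd d) \<le> ennreal (euclid_norm d y powr \<tau>) + ennreal step_moment"
    using transition_moment[OF y] by (simp add: transition_pdf_commute[of d \<eta> _ y])
  have "norm_moment d \<tau> (backward_kernel d \<pi> \<eta> y) = (\<integral>\<^sup>+ x. ?f x * (\<pi> x * ?w x) / Z \<partial>Rd d)"
    unfolding norm_moment_def backward_kernel_def using y
    by (subst nn_integral_density)
      (auto simp: normalize_pdf_def Z_def ennreal_times_divide mult.commute intro!: nn_integral_cong)
  also have "\<dots> = (\<integral>\<^sup>+ x. ?f x * (\<pi> x * ?w x) \<partial>Rd d) / Z"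
    using y by (intro nn_integral_divide) auto
  also have "\<dots> \<le> ((\<integral>\<^sup>+ x. ?f x * ?w x \<partial>Rd d) * Z) / Z"
  proof (intro divide_right_mono_ennreal)
    show "(\<integral>\<^sup>+ x. ?f x * (\<pi> x * ?w x) \<partial>Rd d) \<le> (\<integral>\<^sup>+ x. ?f x * ?w x \<partial>Rd d) * Z"
      unfolding Z_def
    proof (rule nn_integral_mult_le_antimonotone)
      show "(\<integral>\<^sup>+ x. ?f x * ?w x \<partial>Rd d) < \<infinity>"
        using fw by (rule le_less_trans) (simp add: ennreal_plus[symmetric] step_moment_nonneg del: ennreal_plus)
      show "\<pi> z \<le> \<pi> x" if "?f x < ?f z" for x z
      proof (rule \<pi>_antimono, rule ccontr)
        assume "\<not> euclid_norm d x \<le> euclid_norm d z"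
        then have "euclid_norm d z powr \<tau> \<le> euclid_norm d x powr \<tau>"
          using \<tau> by (intro powr_mono2) auto
        with that show False by (simp add: ennreal_less_iff)
      qed
    qed (use y w \<pi>_le in auto)
  qed
  also have "\<dots> = (\<integral>\<^sup>+ x. ?f x * ?w x \<partial>Rd d)"
    using Z by (simp add: ennreal_mult_divide_eq)
  finally show ?thesis using fw by simp
qed

lemma norm_moment_bind:
  assumes \<rho>: "\<rho> \<in> space (prob_algebra (Rd d))" and K: "K \<in> measurable (Rd d) (prob_algebra (Rd d))"
    and le: "\<And>x. x \<in> space (Rd d) \<Longrightarrow> norm_moment d \<tau> (K x) \<le> ennreal (euclid_norm d x powr \<tau>) + ennreal step_moment"
  shows "norm_moment d \<tau> (\<rho> \<bind> K) \<le> norm_moment d \<tau> \<rho> + ennreal step_moment"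
proof -
  have sets: "sets \<rho> = sets (Rd d)" and "prob_space \<rho>"
    using \<rho> by (auto simp: space_prob_algebra)
  interpret prob_space \<rho> by fact
  have [measurable_cong]: "sets \<rho> = sets (Rd d)" by fact
  have "norm_moment d \<tau> (\<rho> \<bind> K) = (\<integral>\<^sup>+ x. norm_moment d \<tau> (K x) \<partial>\<rho>)"
    unfolding norm_moment_def
    by (rule nn_integral_bind[where B = "Rd d"])
      (use measurable_prob_algebraD[OF K] sets in \<open>auto cong: measurable_cong_sets\<close>)
  also have "\<dots> \<le> (\<integral>\<^sup>+ x. ennreal (euclid_norm d x powr \<tau>) + ennreal step_moment \<partial>\<rho>)"
    using le sets_eq_imp_space_eq[OF sets] by (intro nn_integral_mono) auto
  also have "\<dots> = norm_moment d \<tau> \<rho> + ennreal step_moment"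
    by (subst nn_integral_add) (auto simp: norm_moment_def emeasure_space_1)
  finally show ?thesis .
qed

text \<open>Each iteration costs two step moments, one per kernel. Membership in
  \<open>prob_algebra\<close> is carried along because the bound for bind needs it at every
  stage.\<close>

lemma sampler_law_moment:
  assumes \<rho>: "\<rho> \<in> space (prob_algebra (Rd d))"
  shows "sampler_law d \<pi> \<eta> \<rho> N \<in> space (prob_algebra (Rd d)) \<and>
    norm_moment d \<tau> (sampler_law d \<pi> \<eta> \<rho> N) \<le> norm_moment d \<tau> \<rho> + ennreal (N * (2 * step_moment))"
proof (induction N)
  case 0
  show ?case using \<rho> by simp
next
  case (Suc N)
  let ?\<mu> = "sampler_law d \<pi> \<eta> \<rho> N" and ?F = "forward_kernel d \<eta>" and ?K = "backward_kernel d \<pi> \<eta>"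
  have bind: "\<mu> \<bind> K \<in> space (prob_algebra (Rd d))"
    if "\<mu> \<in> space (prob_algebra (Rd d))" "K \<in> measurable (Rd d) (prob_algebra (Rd d))" for \<mu> K
    using prob_space_bind'[OF that] sets_bind'[OF that] by (simp add: space_prob_algebra)
  have \<mu>: "?\<mu> \<in> space (prob_algebra (Rd d))" using Suc by simp
  note \<mu>F = bind[OF \<mu> forward_kernel_measurable]
  have "norm_moment d \<tau> (?\<mu> \<bind> ?F \<bind> ?K) \<le> norm_moment d \<tau> (?\<mu> \<bind> ?F) + ennreal step_moment"
    by (intro norm_moment_bind \<mu>F backward_kernel_measurable backward_moment)
  also have "norm_moment d \<tau> (?\<mu> \<bind> ?F) \<le> norm_moment d \<tau> ?\<mu> + ennreal step_moment"
    by (intro norm_moment_bind \<mu> forward_kernel_measurable forward_moment)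
  also have "norm_moment d \<tau> ?\<mu> \<le> norm_moment d \<tau> \<rho> + ennreal (N * (2 * step_moment))"
    using Suc by simp
  also have "norm_moment d \<tau> \<rho> + ennreal (N * (2 * step_moment)) + ennreal step_moment + ennreal step_moment
     = norm_moment d \<tau> \<rho> + ennreal (Suc N * (2 * step_moment))"
    using step_moment_nonneg
    by (simp add: add.assoc ennreal_plus[symmetric] algebra_simps del: ennreal_plus)
  finally show ?case
    using bind[OF \<mu>F backward_kernel_measurable] by (simp add: add_right_mono)
qed

end

end

section \<open>Tail of the target and the lower bound\<close>

lemma sets_target [simp]: "sets (target d \<nu>) = sets (Rd d)"
  and space_target [simp]: "space (target d \<nu>) = space (Rd d)"
  by (simp_all add: target_def)

lemma target_weight_total:
  assumes "d \<ge> 1" "0 < \<nu>"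
  shows "(\<integral>\<^sup>+ x. ennreal (radial_weight d \<nu> 1 (euclid_norm d x)) \<partial>Rd d) \<noteq> 0"
    and "(\<integral>\<^sup>+ x. ennreal (radial_weight d \<nu> 1 (euclid_norm d x)) \<partial>Rd d) < \<infinity>"
  using assms weight_total_nonzero[of 1 d \<nu>] weight_total_finite[of d \<nu> 1] by auto

lemma prob_space_target:
  assumes "d \<ge> 1" "0 < \<nu>"
  shows "prob_space (target d \<nu>)"
  unfolding target_def using target_weight_total[OF assms]
  by (intro prob_space_densityI) (auto simp: target_pdf_eq intro!: nn_integral_normalize_pdf)

text \<open>The normaliser is at most V d^(-\<nu>/2) (1/(1 - \<nu>) + 1/\<nu>), the tail integral at
  least V R^(-\<nu>) / (e \<nu>), with V = d times the unit ball volume. Since (1 - \<nu>) (1/(1 -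
  \<nu>) + 1/\<nu>) = 1/\<nu>, the quotient of the two is precisely the stated bound.\<close>

lemma target_tail:
  assumes d: "d \<ge> 1" and \<nu>: "0 < \<nu>" "\<nu> < 1" and R: "sqrt d \<le> R"
  shows "exp (- 1) * (1 - \<nu>) * (sqrt d / R) powr \<nu>
    \<le> measure (target d \<nu>) {x \<in> space (Rd d). R \<le> euclid_norm d x}"
proof -
  interpret prob_space "target d \<nu>" using d \<nu> by (intro prob_space_target)
  have Rpos: "R > 0" using d R by (intro less_le_trans[OF _ R]) auto
  let ?w = "\<lambda>x. ennreal (radial_weight d \<nu> 1 (euclid_norm d x))"
  let ?A = "{x \<in> space (Rd d). R \<le> euclid_norm d x}"
  define V where "V = unit_ball_vol (real d) * d"
  have V: "V > 0" using d by (simp add: V_def)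
  define Z where "Z = (\<integral>\<^sup>+ x. ?w x \<partial>Rd d)"
  have "Z \<le> (\<integral>\<^sup>+ x. ?w x * indicator {..<sqrt d} (euclid_norm d x)
      + ennreal (euclid_norm d x powr 0 * radial_weight d \<nu> 1 (euclid_norm d x)) * indicator {sqrt d..} (euclid_norm d x) \<partial>Rd d)"
    unfolding Z_def using d by (intro nn_integral_mono) (auto split: split_indicator)
  also have "\<dots> = (\<integral>\<^sup>+ x. ?w x * indicator {..<sqrt d} (euclid_norm d x) \<partial>Rd d)
      + (\<integral>\<^sup>+ x. ennreal (euclid_norm d x powr 0 * radial_weight d \<nu> 1 (euclid_norm d x)) * indicator {sqrt d..} (euclid_norm d x) \<partial>Rd d)"
    by (rule nn_integral_add) auto
  also have "\<dots> \<le> ennreal (unit_ball_vol d * d * (d powr (- \<nu> / 2) / (1 - \<nu>)))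
      + ennreal (unit_ball_vol d * d * (sqrt d powr (0 - \<nu>) / (\<nu> - 0)))"
    using d \<nu> by (intro add_mono weight_ball_upper weight_tail_upper) auto
  also have "\<dots> = ennreal (V * (sqrt d powr (- \<nu>) * (1 / (1 - \<nu>) + 1 / \<nu>)))"
  proof -
    have "sqrt d powr (- \<nu>) = d powr (- \<nu> / 2)"
      using d by (simp add: powr_half_sqrt[symmetric] powr_powr)
    then show ?thesis
      using d \<nu> by (subst ennreal_plus[symmetric]) (auto simp: V_def distrib_left)
  qed
  finally have Zle: "Z \<le> ennreal (V * (sqrt d powr (- \<nu>) * (1 / (1 - \<nu>) + 1 / \<nu>)))" .
  have Z: "Z \<noteq> 0" "Z < \<infinity>"
    using target_weight_total[OF d \<nu>(1)] by (simp_all add: Z_def)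
  define q where "q = exp (- 1) * (1 - \<nu>) * (sqrt d / R) powr \<nu>"
  have q: "q \<ge> 0" using \<nu> by (simp add: q_def)
  have "q * (V * (sqrt d powr (- \<nu>) * (1 / (1 - \<nu>) + 1 / \<nu>))) = V * (exp (- 1) * (R powr (- \<nu>) / \<nu>))"
  proof -
    have "(1 - \<nu>) * (1 / (1 - \<nu>) + 1 / \<nu>) = 1 / \<nu>"
      using \<nu> by (simp add: field_simps)
    moreover have "(sqrt d / R) powr \<nu> * sqrt d powr (- \<nu>) = R powr (- \<nu>)"
      using d Rpos by (simp add: powr_divide powr_minus field_simps)
    moreover have "exp (- 1) * (1 - \<nu>) * (sqrt d / R) powr \<nu> * (V * (sqrt d powr (- \<nu>) * s))
      = V * (exp (- 1) * (((sqrt d / R) powr \<nu> * sqrt d powr (- \<nu>)) * ((1 - \<nu>) * s)))" for s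
      by (simp only: mult_ac)
    ultimately show ?thesis by (simp only: q_def mult_1_right times_divide_eq_right)
  qed
  then have "ennreal q * Z \<le> ennreal (V * (exp (- 1) * (R powr (- \<nu>) / \<nu>)))"
    using mult_left_mono[OF Zle, of "ennreal q"] q by (simp add: ennreal_mult'[symmetric])
  also have "\<dots> \<le> (\<integral>\<^sup>+ x. ?w x * indicator {R..} (euclid_norm d x) \<partial>Rd d)"
    unfolding V_def using d \<nu> R by (intro weight_tail_lower) auto
  finally have "ennreal q * Z / Z \<le> (\<integral>\<^sup>+ x. ?w x * indicator {R..} (euclid_norm d x) \<partial>Rd d) / Z"
    by (rule divide_right_mono_ennreal)
  then have "ennreal q \<le> (\<integral>\<^sup>+ x. ?w x * indicator {R..} (euclid_norm d x) \<partial>Rd d) / Z"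
    using Z by (simp add: ennreal_mult_divide_eq)
  also have "\<dots> = (\<integral>\<^sup>+ x. ?w x * indicator {R..} (euclid_norm d x) / Z \<partial>Rd d)"
    by (rule nn_integral_divide[symmetric]) auto
  also have "\<dots> = emeasure (target d \<nu>) ?A"
    unfolding target_def target_pdf_eq
    by (subst emeasure_density)
      (auto simp: normalize_pdf_def Z_def split: split_indicator intro!: nn_integral_cong)
  finally show ?thesis
    by (simp add: emeasure_eq_measure q_def)
qed

text \<open>A real supremum dominates its members only if the family is bounded above; for
  probability measures 1 is a bound.\<close>

lemma abs_measure_diff_le_tv_dist:
  assumes "prob_space \<mu>" "prob_space \<rho>" "A \<in> sets \<mu>"
  shows "\<bar>measure \<mu> A - measure \<rho> A\<bar> \<le> tv_dist \<mu> \<rho>"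
  unfolding tv_dist_def
proof (rule cSUP_upper)
  interpret \<mu>: prob_space \<mu> by fact
  interpret \<rho>: prob_space \<rho> by fact
  show "bdd_above ((\<lambda>A. \<bar>measure \<mu> A - measure \<rho> A\<bar>) ` sets \<mu>)"
  proof (intro bdd_aboveI2)
    show "\<bar>measure \<mu> A - measure \<rho> A\<bar> \<le> 1" for A
      using \<mu>.prob_le_1[of A] \<rho>.prob_le_1[of A] measure_nonneg[of \<mu> A] measure_nonneg[of \<rho> A]
      by linarith
  qed
qed fact

lemma radial_sampler_target:
  assumes "d \<ge> 1" "\<eta> > 0" "0 < \<nu>"
  shows "\<exists>B. radial_sampler d \<eta> (target_pdf d \<nu>) B"
proof -
  define Z where "Z = (\<integral>\<^sup>+ x. ennreal (radial_weight d \<nu> 1 (euclid_norm d x)) \<partial>Rd d)"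
  have Z: "Z \<noteq> 0" "Z < \<infinity>"
    using target_weight_total[OF assms(1,3)] by (simp_all add: Z_def)
  have pdf: "target_pdf d \<nu> x = ennreal (radial_weight d \<nu> 1 (euclid_norm d x)) / Z" for x
    by (simp add: target_pdf_eq normalize_pdf_def Z_def)
  have anti: "target_pdf d \<nu> y \<le> target_pdf d \<nu> x" if "euclid_norm d x \<le> euclid_norm d y" for x y
    unfolding pdf using that assms
    by (intro divide_right_mono_ennreal ennreal_leI radial_weight_antimono) auto
  \<comment> \<open>A radially decreasing density is largest at the origin, whence the
    bound.\<close>
  have "radial_sampler d \<eta> (target_pdf d \<nu>) (ennreal (radial_weight d \<nu> 1 0) / Z)"
  proof
    show "0 < target_pdf d \<nu> x" for x
      using Z by (simp add: pdf ennreal_zero_less_divide radial_weight_pos)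
    show "target_pdf d \<nu> x \<le> ennreal (radial_weight d \<nu> 1 0) / Z" for x
      unfolding pdf using assms
      by (intro divide_right_mono_ennreal ennreal_leI radial_weight_antimono) auto
    show "ennreal (radial_weight d \<nu> 1 0) / Z < \<infinity>"
      using Z by (simp add: ennreal_divide_eq_top_iff less_top[symmetric])
  qed (use assms anti in auto)
  then show ?thesis by blast
qed

lemma norm_moment_bounded_init:
  assumes \<rho>: "bounded_init d C\<^sub>0 \<rho>" and "0 < C\<^sub>0" "0 < \<tau>"
  shows "norm_moment d \<tau> \<rho> \<le> ennreal ((C\<^sub>0 * sqrt d) powr \<tau>)"
proof -
  interpret prob_space \<rho> using \<rho> by (simp add: bounded_init_def)
  have "norm_moment d \<tau> \<rho> \<le> (\<integral>\<^sup>+ x. ennreal ((C\<^sub>0 * sqrt d) powr \<tau>) \<partial>\<rho>)"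
    unfolding norm_moment_def
  proof (intro nn_integral_mono_AE)
    have "AE x in \<rho>. euclid_norm d x \<le> C\<^sub>0 * sqrt d" using \<rho> by (simp add: bounded_init_def)
    then show "AE x in \<rho>. ennreal (euclid_norm d x powr \<tau>) \<le> ennreal ((C\<^sub>0 * sqrt d) powr \<tau>)"
      by eventually_elim (use assms in \<open>auto intro!: ennreal_leI powr_mono2\<close>)
  qed
  then show ?thesis by (simp add: emeasure_space_1)
qed

lemma norm_moment_Markov:
  assumes \<rho>: "\<rho> \<in> space (prob_algebra (Rd d))" and R: "R > 0" and "\<tau> > 0"
  shows "ennreal (R powr \<tau> * measure \<rho> {x \<in> space (Rd d). R \<le> euclid_norm d x}) \<le> norm_moment d \<tau> \<rho>"
proof -
  have sets: "sets \<rho> = sets (Rd d)" and "prob_space \<rho>"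
    using \<rho> by (auto simp: space_prob_algebra)
  interpret prob_space \<rho> by fact
  have [measurable_cong]: "sets \<rho> = sets (Rd d)" by fact
  let ?A = "{x \<in> space (Rd d). R \<le> euclid_norm d x}"
  have "?A \<in> sets \<rho>" unfolding sets by measurable
  then have "ennreal (R powr \<tau> * measure \<rho> ?A) = (\<integral>\<^sup>+ x. ennreal (R powr \<tau>) * indicator ?A x \<partial>\<rho>)"
    by (simp add: nn_integral_cmult_indicator emeasure_eq_measure ennreal_mult)
  also have "\<dots> \<le> norm_moment d \<tau> \<rho>"
    unfolding norm_moment_def using R \<open>\<tau> > 0\<close>
    by (intro nn_integral_mono) (auto split: split_indicator intro!: ennreal_leI powr_mono2)
  finally show ?thesis .
qed

text \<open>The tail mass of the iterate beyond R is squeezed between the target tail minus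
  \<epsilon> and the Markov bound. R stays free here and is optimised below.\<close>

lemma sampler_tail_inequality:
  assumes d: "d \<ge> 1" and \<eta>: "\<eta> > 0" and \<nu>: "0 < \<nu>" "\<nu> < 1" and \<tau>: "0 < \<tau>" "\<tau> < 1"
    and C\<^sub>0: "0 < C\<^sub>0" and \<rho>: "bounded_init d C\<^sub>0 \<rho>" and R: "sqrt d \<le> R"
    and tv: "tv_dist (target d \<nu>) (sampler_law d (target_pdf d \<nu>) \<eta> \<rho> N) \<le> \<epsilon>"
  shows "R powr \<tau> * (exp (- 1) * (1 - \<nu>) * (sqrt d / R) powr \<nu> - \<epsilon>)
    \<le> (C\<^sub>0 * sqrt d) powr \<tau> + N * (2 * ((\<eta> * sqrt d) powr \<tau> * (1 + exp 1 / (1 - \<tau>))))"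
proof -
  obtain B where "radial_sampler d \<eta> (target_pdf d \<nu>) B"
    using radial_sampler_target d \<eta> \<nu> by blast
  then interpret radial_sampler d \<eta> "target_pdf d \<nu>" B .
  let ?\<mu> = "sampler_law d (target_pdf d \<nu>) \<eta> \<rho> N"
  let ?A = "{x \<in> space (Rd d). R \<le> euclid_norm d x}"
  have Rpos: "R > 0" using d R by (intro less_le_trans[OF _ R]) auto
  have "\<rho> \<in> space (prob_algebra (Rd d))"
    using \<rho> by (simp add: bounded_init_def space_prob_algebra)
  note mom = sampler_law_moment[OF \<tau> this, of N]
  then have \<mu>: "?\<mu> \<in> space (prob_algebra (Rd d))" by simp
  have "ennreal (R powr \<tau> * measure ?\<mu> ?A) \<le> norm_moment d \<tau> ?\<mu>"
    using \<mu> Rpos \<tau> by (intro norm_moment_Markov)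
  also have "\<dots> \<le> norm_moment d \<tau> \<rho> + ennreal (N * (2 * step_moment \<tau>))"
    using mom by simp
  also have "\<dots> \<le> ennreal ((C\<^sub>0 * sqrt d) powr \<tau>) + ennreal (N * (2 * step_moment \<tau>))"
    using \<rho> C\<^sub>0 \<tau> by (intro add_right_mono norm_moment_bounded_init)
  also have "\<dots> = ennreal ((C\<^sub>0 * sqrt d) powr \<tau> + N * (2 * step_moment \<tau>))"
    using step_moment_nonneg[OF \<tau>] by simp
  finally have markov: "R powr \<tau> * measure ?\<mu> ?A \<le> (C\<^sub>0 * sqrt d) powr \<tau> + N * (2 * step_moment \<tau>)"
    using step_moment_nonneg[OF \<tau>] by (subst (asm) ennreal_le_iff) auto
  have "\<bar>measure (target d \<nu>) ?A - measure ?\<mu> ?A\<bar> \<le> tv_dist (target d \<nu>) ?\<mu>"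
    using prob_space_target[OF d \<nu>(1)] \<mu>
    by (intro abs_measure_diff_le_tv_dist) (auto simp: space_prob_algebra)
  with tv have "measure (target d \<nu>) ?A - \<epsilon> \<le> measure ?\<mu> ?A" by linarith
  with target_tail[OF d \<nu> R] have "exp (- 1) * (1 - \<nu>) * (sqrt d / R) powr \<nu> - \<epsilon> \<le> measure ?\<mu> ?A"
    by linarith
  then have "R powr \<tau> * (exp (- 1) * (1 - \<nu>) * (sqrt d / R) powr \<nu> - \<epsilon>) \<le> R powr \<tau> * measure ?\<mu> ?A"
    by (intro mult_left_mono) auto
  with markov show ?thesis
    unfolding step_moment_def[OF \<tau>] by linarith
qed

section \<open>Choice of the cutoff and of the constants\<close>

text \<open>From \<nu> < 1 one gets L \<ge> d, and L enters with a negative exponent, so the upper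
  bound on \<eta> becomes a power of d alone. The lower constant \<open>c\<^sub>1\<close> gives
  positivity.\<close>

lemma step_size_order_bounds:
  assumes step: "step_size_order c\<^sub>1 c\<^sub>2 d \<nu> \<eta>" and c: "0 < c\<^sub>1" "c\<^sub>1 \<le> c\<^sub>2"
    and \<nu>: "0 < \<nu>" "\<nu> < 1" and d: "d \<ge> 1"
  shows "0 < \<eta>" "\<eta> \<le> c\<^sub>2 * d powr (- (1 / 2 + 4 / \<nu>))"
proof -
  let ?L = "holder_const d \<nu>"
  have L: "real d \<le> ?L"
    using \<nu> d by (simp add: holder_const_def field_simps add_increasing)
  then have "?L > 0" using d by simp
  then have "0 < c\<^sub>1 * (?L powr (- 4 / \<nu>) * real d powr (- 1 / 2))"
    using c d by (intro mult_pos_pos) auto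
  with step show "0 < \<eta>" by (simp add: step_size_order_def)
  have "?L powr (- 4 / \<nu>) \<le> real d powr (- 4 / \<nu>)"
    using L d \<nu> by (intro powr_mono2') auto
  then have "c\<^sub>2 * (?L powr (- 4 / \<nu>) * real d powr (- 1 / 2))
     \<le> c\<^sub>2 * (real d powr (- 4 / \<nu>) * real d powr (- 1 / 2))"
    using c by (intro mult_left_mono mult_right_mono) auto
  also have "real d powr (- 4 / \<nu>) * real d powr (- 1 / 2) = d powr (- (1 / 2 + 4 / \<nu>))"
  proof -
    have "- 4 / \<nu> + - 1 / 2 = - (1 / 2 + 4 / \<nu>)"
      using \<nu> by (simp add: field_simps)
    then show ?thesis by (simp only: powr_add[symmetric])
  qed
  finally show "\<eta> \<le> c\<^sub>2 * d powr (- (1 / 2 + 4 / \<nu>))"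
    using step by (simp add: step_size_order_def)
qed

lemma iterations_lower_bound:
  fixes \<nu> \<tau> C\<^sub>0 c\<^sub>1 c\<^sub>2 :: real
  assumes \<nu>: "0 < \<nu>" "\<nu> < 1" and \<tau>: "\<nu> < \<tau>" "\<tau> < 1"
    and C\<^sub>0: "0 < C\<^sub>0" and c: "0 < c\<^sub>1" "c\<^sub>1 \<le> c\<^sub>2"
  shows "\<exists>c>0. \<exists>\<epsilon>\<^sub>0>0. \<forall>d\<ge>1. \<forall>\<epsilon>. 0 < \<epsilon> \<and> \<epsilon> \<le> \<epsilon>\<^sub>0 \<longrightarrow>
    (\<forall>\<eta> \<rho>\<^sub>0 N. step_size_order c\<^sub>1 c\<^sub>2 d \<nu> \<eta> \<and> bounded_init d C\<^sub>0 \<rho>\<^sub>0 \<and>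
       tv_dist (target d \<nu>) (sampler_law d (target_pdf d \<nu>) \<eta> \<rho>\<^sub>0 N) \<le> \<epsilon> \<longrightarrow>
       real N \<ge> c * (d powr (\<tau> * (1 / 2 + 4 / \<nu>)) * \<epsilon> powr (- ((\<tau> - \<nu>) / \<nu>))))"
proof -
  \<comment> \<open>\<open>\<kappa>\<close> is the constant of \<open>target_tail\<close>;
    \<open>\<beta>\<close> is the exponent left when T^\<tau>, of order \<epsilon>^(-\<tau>/\<nu>),
    is multiplied by \<epsilon>.\<close>
  define \<kappa> where "\<kappa> = exp (- 1) * (1 - \<nu>)"
  define \<beta> where "\<beta> = (\<tau> - \<nu>) / \<nu>"
  define K where "K = 1 + exp 1 / (1 - \<tau>)"
  define A where "A = (2 / \<kappa>) powr (- (\<tau> / \<nu>))"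
  \<comment> \<open>The 4 consists of two step moments per iteration and a factor 2 for absorbing
    the initial moment.\<close>
  define c where "c = A / (4 * K * c\<^sub>2 powr \<tau>)"
  \<comment> \<open>The first entry ensures T \<ge> 1, so that the cutoff is at least sqrt d; the
    second makes the initial moment at most half of \<open>A * X\<close>.\<close>
  define \<epsilon>\<^sub>0 where "\<epsilon>\<^sub>0 = min (\<kappa> / 2) ((2 * C\<^sub>0 powr \<tau> / A) powr (- (1 / \<beta>)))"
  have \<kappa>: "\<kappa> > 0" and \<beta>: "\<beta> > 0" and A: "A > 0" and c2: "c\<^sub>2 > 0" and \<tau>0: "\<tau> > 0"
    using assms by (auto simp: \<kappa>_def \<beta>_def A_def)
  have K: "K > 0"
    using \<tau> by (auto simp: K_def intro!: add_pos_pos)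
  have "c > 0"
    using A K c2 by (simp add: c_def)
  moreover have "\<epsilon>\<^sub>0 > 0"
    using \<kappa> A C\<^sub>0 by (simp add: \<epsilon>\<^sub>0_def)
  moreover have "real N \<ge> c * (d powr (\<tau> * (1 / 2 + 4 / \<nu>)) * \<epsilon> powr (- \<beta>))"
    if d: "d \<ge> 1" and \<epsilon>: "0 < \<epsilon>" "\<epsilon> \<le> \<epsilon>\<^sub>0" and step: "step_size_order c\<^sub>1 c\<^sub>2 d \<nu> \<eta>"
      and init: "bounded_init d C\<^sub>0 \<rho>\<^sub>0"
      and tv: "tv_dist (target d \<nu>) (sampler_law d (target_pdf d \<nu>) \<eta> \<rho>\<^sub>0 N) \<le> \<epsilon>"
    for d \<epsilon> \<eta> \<rho>\<^sub>0 N
  proof -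
    note \<eta> = step_size_order_bounds[OF step c \<nu> d]
    define X where "X = \<epsilon> powr (- \<beta>)"
    \<comment> \<open>The cutoff is R = sqrt d * T, with T chosen so that the lower bound for the
      target tail is exactly 2 \<epsilon>; after subtracting the allowed error, \<epsilon>
      remains.\<close>
    define T where "T = (2 * \<epsilon> / \<kappa>) powr (- (1 / \<nu>))"
    define D where "D = real d powr (\<tau> * (1 / 2 + 4 / \<nu>))"
    have D: "D > 0" using d by (simp add: D_def)
    have small: "0 < 2 * \<epsilon> / \<kappa>" "2 * \<epsilon> / \<kappa> \<le> 1"
      using \<epsilon> \<kappa> by (auto simp: \<epsilon>\<^sub>0_def field_simps)
    then have "1 powr (- (1 / \<nu>)) \<le> T"
      unfolding T_def using \<nu> by (intro powr_mono2') auto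
    then have T: "T \<ge> 1" by simp
    have sd: "sqrt d > 0" using d by simp
    have "(sqrt d / (sqrt d * T)) powr \<nu> = T powr (- \<nu>)"
      using sd T by (simp add: powr_divide powr_minus_divide)
    also have "\<dots> = 2 * \<epsilon> / \<kappa>"
      using small \<nu> \<kappa> \<epsilon> by (simp add: T_def powr_powr)
    finally have tail: "exp (- 1) * (1 - \<nu>) * (sqrt d / (sqrt d * T)) powr \<nu> - \<epsilon> = \<epsilon>"
      using \<kappa> by (simp add: \<kappa>_def[symmetric])
    have "T powr \<tau> = (2 / \<kappa>) powr (- (\<tau> / \<nu>)) * \<epsilon> powr (- (\<tau> / \<nu>))"
      using small \<kappa> \<epsilon> by (simp add: T_def powr_powr powr_mult[symmetric])
    moreover have "\<epsilon> powr (- (\<tau> / \<nu>)) * \<epsilon> = X"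
    proof -
      have "\<epsilon> powr (- (\<tau> / \<nu>)) * \<epsilon> powr 1 = X"
        unfolding powr_add[symmetric] X_def \<beta>_def using \<nu> by (simp add: diff_divide_distrib)
      then show ?thesis using \<epsilon> by simp
    qed
    ultimately have TX: "T powr \<tau> * \<epsilon> = A * X"
      by (simp add: A_def)
    have "(sqrt d * T) powr \<tau> * (exp (- 1) * (1 - \<nu>) * (sqrt d / (sqrt d * T)) powr \<nu> - \<epsilon>)
      \<le> (C\<^sub>0 * sqrt d) powr \<tau> + N * (2 * ((\<eta> * sqrt d) powr \<tau> * (1 + exp 1 / (1 - \<tau>))))"
      by (rule sampler_tail_inequality) (use d \<eta> \<nu> \<tau> \<tau>0 C\<^sub>0 init tv T in auto)
    \<comment> \<open>Cutoff, initial radius and step displacement share the factor (sqrt d)^\<tau>.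
      Once it is cancelled, the dimension is present only in \<open>\<eta>\<close>.\<close>
    then have "sqrt d powr \<tau> * (T powr \<tau> * \<epsilon>) \<le> sqrt d powr \<tau> * (C\<^sub>0 powr \<tau> + N * (2 * (\<eta> powr \<tau> * K)))"
      unfolding tail K_def[symmetric] using sd T C\<^sub>0 \<eta> by (simp add: powr_mult algebra_simps)
    then have AX: "A * X \<le> C\<^sub>0 powr \<tau> + N * (2 * (\<eta> powr \<tau> * K))"
      using sd by (simp add: TX)
    have "((2 * C\<^sub>0 powr \<tau> / A) powr (- (1 / \<beta>))) powr (- \<beta>) \<le> X"
      unfolding X_def using \<epsilon> \<beta> by (intro powr_mono2') (auto simp: \<epsilon>\<^sub>0_def)
    then have "2 * C\<^sub>0 powr \<tau> / A \<le> X"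
      using \<beta> C\<^sub>0 A by (simp add: powr_powr)
    then have "2 * C\<^sub>0 powr \<tau> \<le> A * X"
      using A by (simp add: field_simps)
    with AX have "A * X \<le> 4 * K * N * \<eta> powr \<tau>" by (simp add: algebra_simps)
    also have "\<eta> powr \<tau> \<le> (c\<^sub>2 * d powr (- (1 / 2 + 4 / \<nu>))) powr \<tau>"
      using \<eta> \<tau>0 by (intro powr_mono2) auto
    also have "\<dots> = c\<^sub>2 powr \<tau> / D"
    proof -
      have "(real d powr (- (1 / 2 + 4 / \<nu>))) powr \<tau> = 1 / D"
        unfolding D_def powr_powr by (simp only: mult_minus_left mult.commute[of \<tau>] powr_minus_divide)
      with c2 show ?thesis by (simp add: powr_mult)
    qed
    finally have "A * X \<le> 4 * K * N * (c\<^sub>2 powr \<tau> / D)"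
      using K by (simp add: mult_left_mono)
    then show ?thesis
      unfolding c_def X_def[symmetric] D_def[symmetric] using D K c2 by (simp add: field_simps)
  qed
  ultimately show ?thesis unfolding \<beta>_def by blast
qed

section \<open>Comparison of the exponents\<close>

text \<open>For d \<ge> 1 and \<epsilon> \<le> 1 each factor on the right is at least 1, so raising
  it to the power 2 / (2 + \<tau>) < 1 cannot increase it.\<close>

lemma iteration_rate_le:
  fixes \<nu> \<tau> \<epsilon> :: real
  assumes \<nu>: "0 < \<nu>" and \<tau>: "\<nu> < \<tau>" and d: "d \<ge> 1" and \<epsilon>: "0 < \<epsilon>" "\<epsilon> \<le> 1"
  shows "iteration_rate \<nu> \<tau> d \<epsilon> \<le> d powr (\<tau> * (1 / 2 + 4 / \<nu>)) * \<epsilon> powr (- ((\<tau> - \<nu>) / \<nu>))"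
proof -
  have "iteration_rate \<nu> \<tau> d \<epsilon> = d powr (\<tau> * (1 / 2 + 4 / \<nu>) * (2 / (2 + \<tau>)))
      * \<epsilon> powr (- ((\<tau> - \<nu>) / \<nu>) * (2 / (2 + \<tau>)))"
  proof -
    have "(\<tau> + 8 * \<tau> / \<nu>) / (2 + \<tau>) = \<tau> * (1 / 2 + 4 / \<nu>) * (2 / (2 + \<tau>))"
      using \<nu> \<tau> by (simp add: divide_simps) (simp add: algebra_simps)
    moreover have "- (2 * (\<tau> - \<nu>)) / (\<nu> * (2 + \<tau>)) = - ((\<tau> - \<nu>) / \<nu>) * (2 / (2 + \<tau>))"
      using \<nu> \<tau> by (auto simp: divide_simps algebra_simps)
    ultimately show ?thesis by (simp only: iteration_rate_def)
  qed
  also have "\<dots> \<le> d powr (\<tau> * (1 / 2 + 4 / \<nu>) * 1) * \<epsilon> powr (- ((\<tau> - \<nu>) / \<nu>) * 1)"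
    using \<nu> \<tau> d \<epsilon>
    by (intro mult_mono powr_mono powr_mono' mult_left_mono mult_left_mono_neg) (auto simp: field_simps)
  finally show ?thesis by simp
qed

text \<open>With x = ln (d/\<epsilon>) and \<delta> = ln x / x the choice is \<tau> = 1 - \<delta>,
  and (d/\<epsilon>)^\<delta> = x. A loss of order \<delta> in an exponent thus costs only a power
  of the logarithm. The d exponent loses at most (1 + 8/\<nu>) \<delta> and the \<epsilon> exponent
  at most (2/\<nu>) \<delta>, which add up to the 1 + 10/\<nu> in the condition on p.\<close>

lemma iteration_rate_tau_choice:
  fixes \<nu> \<epsilon> :: real
  assumes \<nu>: "0 < \<nu>" "\<nu> < 1" and d: "d \<ge> 1" and \<epsilon>: "0 < \<epsilon>" "\<epsilon> \<le> 1"
    and x: "x = ln (real d / \<epsilon>)" "1 < x" "ln x / x < 1 - \<nu>" and p: "1 + 10 / \<nu> \<le> real p"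
  shows "\<nu> < tau_choice \<nu> d \<epsilon>" "tau_choice \<nu> d \<epsilon> < 1"
    and "d powr ((\<nu> + 8) / (3 * \<nu>)) * \<epsilon> powr (- (2 * (1 - \<nu>)) / (3 * \<nu>)) / x ^ p
      \<le> iteration_rate \<nu> (tau_choice \<nu> d \<epsilon>) d \<epsilon>"
proof -
  define \<delta> where "\<delta> = ln x / x"
  define a where "a = 1 + 8 / \<nu>"
  have \<delta>: "0 < \<delta>" "\<delta> < 1 - \<nu>" "\<delta> < 1"
    using x \<nu> by (auto simp: \<delta>_def)
  have a: "a > 0" using \<nu> by (simp add: a_def add_pos_pos)
  \<comment> \<open>The hypothesis \<open>ln x / x < 1 - \<nu>\<close> says that the maximum is
    attained by its second argument.\<close>
  have tau: "tau_choice \<nu> d \<epsilon> = 1 - \<delta>"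
    using \<delta> by (simp add: tau_choice_def x(1)[symmetric] \<delta>_def[symmetric])
  with \<delta> show "\<nu> < tau_choice \<nu> d \<epsilon>" "tau_choice \<nu> d \<epsilon> < 1" by simp_all
  have \<delta>2: "\<delta> * \<delta> \<le> \<delta>" using \<delta> by (simp add: mult_left_le)
  have "1 / 3 - \<delta> \<le> (1 - \<delta>) / (3 - \<delta>)"
    using \<delta> \<delta>2 by (simp add: field_simps)
  then have "a * (1 / 3 - \<delta>) \<le> a * ((1 - \<delta>) / (3 - \<delta>))"
    using a by (intro mult_left_mono) auto
  also have "a * ((1 - \<delta>) / (3 - \<delta>)) = ((1 - \<delta>) + 8 * (1 - \<delta>) / \<nu>) / (2 + (1 - \<delta>))"
    using \<nu> \<delta> by (simp add: a_def algebra_simps)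
  also have "a * (1 / 3 - \<delta>) = (\<nu> + 8) / (3 * \<nu>) - a * \<delta>"
    using \<nu> by (simp add: a_def field_simps)
  finally have dexp: "(\<nu> + 8) / (3 * \<nu>) - a * \<delta> \<le> ((1 - \<delta>) + 8 * (1 - \<delta>) / \<nu>) / (2 + (1 - \<delta>))" .
  have "(1 - \<nu>) / 3 - \<delta> \<le> (1 - \<delta> - \<nu>) / (3 - \<delta>)"
  proof -
    \<comment> \<open>Multiplying the claim by 3 (3 - \<delta>) reduces it to this inequality, in
      which \<nu> and \<delta> are both below 1.\<close>
    have "\<delta> * (\<nu> + 3 * \<delta>) \<le> \<delta> * 7" using \<nu> \<delta> by (intro mult_left_mono) auto
    then show ?thesis using \<delta> by (simp add: field_simps)
  qed
  then have "2 / \<nu> * ((1 - \<nu>) / 3 - \<delta>) \<le> 2 / \<nu> * ((1 - \<delta> - \<nu>) / (3 - \<delta>))"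
    using \<nu> by (intro mult_left_mono) auto
  also have "2 / \<nu> * ((1 - \<delta> - \<nu>) / (3 - \<delta>)) = 2 * (1 - \<delta> - \<nu>) / (\<nu> * (2 + (1 - \<delta>)))"
    by simp
  also have "2 / \<nu> * ((1 - \<nu>) / 3 - \<delta>) = 2 * (1 - \<nu>) / (3 * \<nu>) - 2 / \<nu> * \<delta>"
    unfolding right_diff_distrib times_divide_times_eq by (simp add: mult.commute)
  finally have eexp: "- (2 * ((1 - \<delta>) - \<nu>)) / (\<nu> * (2 + (1 - \<delta>))) \<le> - (2 * (1 - \<nu>)) / (3 * \<nu>) + 2 / \<nu> * \<delta>"
    unfolding minus_divide_left[symmetric] by linarith
  have d\<epsilon>: "1 \<le> real d" "real d \<le> d / \<epsilon>" "1 / \<epsilon> \<le> d / \<epsilon>" "d / \<epsilon> > 0"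
    using d \<epsilon> by (auto simp: field_simps)
  have "1 / x ^ p = x powr (- real p)"
    using x by (simp add: powr_minus_divide powr_realpow)
  also have "\<dots> \<le> x powr (- (a + 2 / \<nu>))"
    using x p \<nu> by (intro powr_mono) (auto simp: a_def field_simps)
  also have "\<dots> = (d / \<epsilon>) powr (- (a * \<delta>)) * (d / \<epsilon>) powr (- (2 / \<nu> * \<delta>))"
  proof -
    have ln_x: "ln x = x * \<delta>" using x by (simp add: \<delta>_def)
    have "- (a + 2 / \<nu>) * ln x = (- (a * \<delta>) + - (2 / \<nu> * \<delta>)) * x"
      unfolding ln_x by (simp add: algebra_simps)
    then show ?thesis
      unfolding powr_add[symmetric] using x(2) d \<epsilon> by (simp add: powr_def x(1)[symmetric])
  qed
  \<comment> \<open>Both d and 1/\<epsilon> are at most d/\<epsilon>, and the exponents are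
    negative, so the two factors may be separated.\<close>
  also have "\<dots> \<le> d powr (- (a * \<delta>)) * (1 / \<epsilon>) powr (- (2 / \<nu> * \<delta>))"
    using d\<epsilon> a \<delta> \<nu> \<epsilon> by (intro mult_mono powr_mono2') auto
  also have "(1 / \<epsilon>) powr (- (2 / \<nu> * \<delta>)) = \<epsilon> powr (2 / \<nu> * \<delta>)"
    using \<epsilon> by (simp add: powr_divide powr_minus_divide)
  finally have pow: "1 / x ^ p \<le> d powr (- (a * \<delta>)) * \<epsilon> powr (2 / \<nu> * \<delta>)" .
  have "d powr ((\<nu> + 8) / (3 * \<nu>)) * \<epsilon> powr (- (2 * (1 - \<nu>)) / (3 * \<nu>)) * (1 / x ^ p)
     \<le> d powr ((\<nu> + 8) / (3 * \<nu>)) * \<epsilon> powr (- (2 * (1 - \<nu>)) / (3 * \<nu>))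
        * (d powr (- (a * \<delta>)) * \<epsilon> powr (2 / \<nu> * \<delta>))"
    using pow by (intro mult_left_mono) auto
  also have "\<dots> = d powr ((\<nu> + 8) / (3 * \<nu>) + - (a * \<delta>)) * \<epsilon> powr (- (2 * (1 - \<nu>)) / (3 * \<nu>) + 2 / \<nu> * \<delta>)"
    by (simp only: powr_add mult_ac)
  also have "\<dots> \<le> iteration_rate \<nu> (1 - \<delta>) d \<epsilon>"
    unfolding iteration_rate_def using dexp eexp d\<epsilon> \<epsilon> by (intro mult_mono powr_mono powr_mono') auto
  finally show "d powr ((\<nu> + 8) / (3 * \<nu>)) * \<epsilon> powr (- (2 * (1 - \<nu>)) / (3 * \<nu>)) / x ^ p
      \<le> iteration_rate \<nu> (tau_choice \<nu> d \<epsilon>) d \<epsilon>"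
    by (simp add: tau)
qed

text \<open>The hidden constants are the existentials placed before d, \<epsilon>, the step size and
  the initial law. In the second claim p is the degree of the polylogarithmic factor, and \<epsilon>
  < 1 keeps ln (d/\<epsilon>) positive.\<close>

theorem corollary3p5:
  fixes \<nu> C\<^sub>0 c\<^sub>1 c\<^sub>2 :: real
  assumes "0 < \<nu>" and "\<nu> < 1" and "0 < C\<^sub>0" and "0 < c\<^sub>1" and "c\<^sub>1 \<le> c\<^sub>2"
  shows
    "(\<forall>\<tau>. \<nu> < \<tau> \<and> \<tau> < 1 \<longrightarrow>
       (\<exists>c>0. \<exists>\<epsilon>\<^sub>0>0. \<forall>d\<ge>1. \<forall>\<epsilon>. 0 < \<epsilon> \<and> \<epsilon> \<le> \<epsilon>\<^sub>0 \<longrightarrow>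
          (\<forall>\<eta> \<rho>\<^sub>0 N. step_size_order c\<^sub>1 c\<^sub>2 d \<nu> \<eta> \<and> bounded_init d C\<^sub>0 \<rho>\<^sub>0 \<and>
             tv_dist (target d \<nu>) (sampler_law d (target_pdf d \<nu>) \<eta> \<rho>\<^sub>0 N) \<le> \<epsilon> \<longrightarrow>
             real N \<ge> c * iteration_rate \<nu> \<tau> d \<epsilon>)))
     \<and>
     (\<exists>c>0. \<exists>p::nat. \<exists>\<epsilon>\<^sub>0>0. \<epsilon>\<^sub>0 < 1 \<and> (\<forall>d\<ge>1. \<forall>\<epsilon>. 0 < \<epsilon> \<and> \<epsilon> \<le> \<epsilon>\<^sub>0 \<longrightarrow>
          \<nu> < tau_choice \<nu> d \<epsilon> \<and> tau_choice \<nu> d \<epsilon> < 1 \<and>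
          iteration_rate \<nu> (tau_choice \<nu> d \<epsilon>) d \<epsilon> \<ge>
            c * (real d powr ((\<nu> + 8) / (3 * \<nu>)) * \<epsilon> powr (- (2 * (1 - \<nu>)) / (3 * \<nu>)))
              / ln (real d / \<epsilon>) ^ p \<and>
          (\<forall>\<eta> \<rho>\<^sub>0 N. step_size_order c\<^sub>1 c\<^sub>2 d \<nu> \<eta> \<and> bounded_init d C\<^sub>0 \<rho>\<^sub>0 \<and>
             tv_dist (target d \<nu>) (sampler_law d (target_pdf d \<nu>) \<eta> \<rho>\<^sub>0 N) \<le> \<epsilon> \<longrightarrow>
             real N \<ge>
               c * (real d powr ((\<nu> + 8) / (3 * \<nu>)) * \<epsilon> powr (- (2 * (1 - \<nu>)) / (3 * \<nu>)))
                 / ln (real d / \<epsilon>) ^ p)))"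
proof (intro conjI allI impI)
  fix \<tau> assume \<tau>: "\<nu> < \<tau> \<and> \<tau> < 1"
  then obtain c \<epsilon>\<^sub>0 where c: "c > 0" and \<epsilon>\<^sub>0: "\<epsilon>\<^sub>0 > 0"
    and bound: "\<And>d \<epsilon> \<eta> \<rho>\<^sub>0 N. d \<ge> 1 \<Longrightarrow> 0 < \<epsilon> \<Longrightarrow> \<epsilon> \<le> \<epsilon>\<^sub>0 \<Longrightarrow> step_size_order c\<^sub>1 c\<^sub>2 d \<nu> \<eta> \<Longrightarrow>
      bounded_init d C\<^sub>0 \<rho>\<^sub>0 \<Longrightarrow>
      tv_dist (target d \<nu>) (sampler_law d (target_pdf d \<nu>) \<eta> \<rho>\<^sub>0 N) \<le> \<epsilon> \<Longrightarrow>
      real N \<ge> c * (d powr (\<tau> * (1 / 2 + 4 / \<nu>)) * \<epsilon> powr (- ((\<tau> - \<nu>) / \<nu>)))"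
    using iterations_lower_bound[of \<nu> \<tau> C\<^sub>0 c\<^sub>1 c\<^sub>2] assms by metis
  show "\<exists>c>0. \<exists>\<epsilon>\<^sub>0>0. \<forall>d\<ge>1. \<forall>\<epsilon>. 0 < \<epsilon> \<and> \<epsilon> \<le> \<epsilon>\<^sub>0 \<longrightarrow>
          (\<forall>\<eta> \<rho>\<^sub>0 N. step_size_order c\<^sub>1 c\<^sub>2 d \<nu> \<eta> \<and> bounded_init d C\<^sub>0 \<rho>\<^sub>0 \<and>
             tv_dist (target d \<nu>) (sampler_law d (target_pdf d \<nu>) \<eta> \<rho>\<^sub>0 N) \<le> \<epsilon> \<longrightarrow>
             real N \<ge> c * iteration_rate \<nu> \<tau> d \<epsilon>)"
  proof (rule exI[of _ c], rule conjI[OF c], rule exI[of _ "min \<epsilon>\<^sub>0 1"], intro conjI allI impI)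
    show "min \<epsilon>\<^sub>0 1 > 0" using \<epsilon>\<^sub>0 by simp
    fix d :: nat and \<epsilon> \<eta> :: real and \<rho>\<^sub>0 N
    assume d: "d \<ge> 1" and \<epsilon>: "0 < \<epsilon> \<and> \<epsilon> \<le> min \<epsilon>\<^sub>0 1"
      and hyp: "step_size_order c\<^sub>1 c\<^sub>2 d \<nu> \<eta> \<and> bounded_init d C\<^sub>0 \<rho>\<^sub>0 \<and>
             tv_dist (target d \<nu>) (sampler_law d (target_pdf d \<nu>) \<eta> \<rho>\<^sub>0 N) \<le> \<epsilon>"
    have "c * iteration_rate \<nu> \<tau> d \<epsilon> \<le> c * (d powr (\<tau> * (1 / 2 + 4 / \<nu>)) * \<epsilon> powr (- ((\<tau> - \<nu>) / \<nu>)))"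
      using assms \<tau> d \<epsilon> c by (intro mult_left_mono iteration_rate_le) auto
    also have "\<dots> \<le> real N"
      using d \<epsilon> hyp by (intro bound) auto
    finally show "real N \<ge> c * iteration_rate \<nu> \<tau> d \<epsilon>" .
  qed
next
  let ?Q = "\<lambda>d \<epsilon>. real d powr ((\<nu> + 8) / (3 * \<nu>)) * \<epsilon> powr (- (2 * (1 - \<nu>)) / (3 * \<nu>))"
  \<comment> \<open>This \<tau> solves (\<tau> - \<nu>)/\<nu> = 2 (1 - \<nu>)/(3 \<nu>), so the
    power of \<epsilon> already agrees with the target rate.\<close>
  define \<tau> where "\<tau> = (2 + \<nu>) / 3"
  have \<tau>: "\<nu> < \<tau>" "\<tau> < 1" using assms by (simp_all add: \<tau>_def)
  then obtain c \<epsilon>\<^sub>0 where c: "c > 0" and \<epsilon>\<^sub>0: "\<epsilon>\<^sub>0 > 0"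
    and bound: "\<And>d \<epsilon> \<eta> \<rho>\<^sub>0 N. d \<ge> 1 \<Longrightarrow> 0 < \<epsilon> \<Longrightarrow> \<epsilon> \<le> \<epsilon>\<^sub>0 \<Longrightarrow> step_size_order c\<^sub>1 c\<^sub>2 d \<nu> \<eta> \<Longrightarrow>
      bounded_init d C\<^sub>0 \<rho>\<^sub>0 \<Longrightarrow>
      tv_dist (target d \<nu>) (sampler_law d (target_pdf d \<nu>) \<eta> \<rho>\<^sub>0 N) \<le> \<epsilon> \<Longrightarrow>
      real N \<ge> c * (d powr (\<tau> * (1 / 2 + 4 / \<nu>)) * \<epsilon> powr (- ((\<tau> - \<nu>) / \<nu>)))"
    using iterations_lower_bound[of \<nu> \<tau> C\<^sub>0 c\<^sub>1 c\<^sub>2] assms by metis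
  have "((\<lambda>x::real. ln x / x) \<longlongrightarrow> 0) at_top" by real_asymp
  then have "eventually (\<lambda>x::real. ln x / x < 1 - \<nu>) at_top"
    using assms by (intro order_tendstoD(2)) auto
  then obtain x\<^sub>0 where x\<^sub>0: "\<And>x. x \<ge> x\<^sub>0 \<Longrightarrow> ln x / x < 1 - \<nu>"
    by (auto simp: eventually_at_top_linorder)
  obtain p :: nat where p: "1 + 10 / \<nu> \<le> real p"
    using real_arch_simple by blast
  \<comment> \<open>The exponential forces ln (d/\<epsilon>) \<ge> max \<open>x\<^sub>0\<close> 2
    for every d \<ge> 1, which yields both conditions on x.\<close>
  define \<epsilon>\<^sub>1 where "\<epsilon>\<^sub>1 = min \<epsilon>\<^sub>0 (exp (- max x\<^sub>0 2))"
  have "\<epsilon>\<^sub>1 > 0" using \<epsilon>\<^sub>0 by (simp add: \<epsilon>\<^sub>1_def)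
  have "\<epsilon>\<^sub>1 < 1" unfolding \<epsilon>\<^sub>1_def by (rule min.strict_coboundedI2) simp
  have main: "(\<nu> < tau_choice \<nu> d \<epsilon> \<and> tau_choice \<nu> d \<epsilon> < 1 \<and>
      iteration_rate \<nu> (tau_choice \<nu> d \<epsilon>) d \<epsilon> \<ge> min c 1 * ?Q d \<epsilon> / ln (real d / \<epsilon>) ^ p) \<and>
      (\<forall>\<eta> \<rho>\<^sub>0 N. step_size_order c\<^sub>1 c\<^sub>2 d \<nu> \<eta> \<and> bounded_init d C\<^sub>0 \<rho>\<^sub>0 \<and>
         tv_dist (target d \<nu>) (sampler_law d (target_pdf d \<nu>) \<eta> \<rho>\<^sub>0 N) \<le> \<epsilon> \<longrightarrow>
         real N \<ge> min c 1 * ?Q d \<epsilon> / ln (real d / \<epsilon>) ^ p)"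
    if d: "d \<ge> 1" and \<epsilon>: "0 < \<epsilon>" "\<epsilon> \<le> \<epsilon>\<^sub>1" for d \<epsilon>
  proof -
    define x where "x = ln (real d / \<epsilon>)"
    have "max x\<^sub>0 2 \<le> - ln \<epsilon>"
    proof -
      have "ln \<epsilon> \<le> ln (exp (- max x\<^sub>0 2))"
        using \<epsilon> by (intro ln_mono) (auto simp: \<epsilon>\<^sub>1_def)
      then show ?thesis by (simp only: ln_exp)
    qed
    also have "- ln \<epsilon> \<le> x"
      using d \<epsilon> by (simp add: x_def ln_div)
    finally have x: "x\<^sub>0 \<le> x" "2 \<le> x" by simp_all
    have Q: "0 \<le> ?Q d \<epsilon>" by simp
    have le1: "\<epsilon> \<le> 1" using \<epsilon> \<open>\<epsilon>\<^sub>1 < 1\<close> by simp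
    note tc = iteration_rate_tau_choice[OF assms(1,2) d \<epsilon>(1) le1 x_def _ x\<^sub>0[OF x(1)] p]
    \<comment> \<open>A single constant must serve the comparison of rates, which holds with 1, and
      the bound on N, which holds with c.\<close>
    have "min c 1 * ?Q d \<epsilon> / x ^ p \<le> ?Q d \<epsilon> / x ^ p"
      using c x mult_right_mono[of "min c 1" 1, OF _ Q] by (intro divide_right_mono) auto
    also have "\<dots> \<le> iteration_rate \<nu> (tau_choice \<nu> d \<epsilon>) d \<epsilon>"
      using x by (intro tc) auto
    finally have rate: "min c 1 * ?Q d \<epsilon> / x ^ p \<le> iteration_rate \<nu> (tau_choice \<nu> d \<epsilon>) d \<epsilon>" .
    have "real N \<ge> min c 1 * ?Q d \<epsilon> / x ^ p"
      if "step_size_order c\<^sub>1 c\<^sub>2 d \<nu> \<eta>" "bounded_init d C\<^sub>0 \<rho>\<^sub>0"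
        "tv_dist (target d \<nu>) (sampler_law d (target_pdf d \<nu>) \<eta> \<rho>\<^sub>0 N) \<le> \<epsilon>" for \<eta> \<rho>\<^sub>0 N
    proof -
      \<comment> \<open>The fixed \<tau> gives the bound on N without a logarithmic factor; dividing
        by x^p only weakens it to the common form.\<close>
      have "1 \<le> x ^ p" using x by simp
      then have "min c 1 * ?Q d \<epsilon> / x ^ p \<le> min c 1 * ?Q d \<epsilon>"
        using c Q by (intro divide_left_mono[of 1 "x ^ p", simplified]) auto
      also have "\<dots> \<le> c * ?Q d \<epsilon>"
        using Q by (intro mult_right_mono) auto
      also have "\<dots> = c * (real d powr ((\<nu> + 8) / (3 * \<nu>)) * \<epsilon> powr (- ((\<tau> - \<nu>) / \<nu>)))"
      proof -
        have "- (2 * (1 - \<nu>)) / (3 * \<nu>) = - ((\<tau> - \<nu>) / \<nu>)"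
          using assms by (simp add: \<tau>_def field_simps)
        then show ?thesis by (simp only:)
      qed
      also have "\<dots>
        \<le> c * (d powr (\<tau> * (1 / 2 + 4 / \<nu>)) * \<epsilon> powr (- ((\<tau> - \<nu>) / \<nu>)))"
      proof -
        \<comment> \<open>The d exponent of the fixed-\<tau> bound is (2 + \<nu>)(\<nu> + 8)/(6
          \<nu>), to be compared with 2 (\<nu> + 8)/(6 \<nu>).\<close>
        have "(2 + \<nu>) * (\<nu> + 8) \<ge> 2 * (\<nu> + 8)"
          using assms by (intro mult_right_mono) auto
        then have "(\<nu> + 8) / (3 * \<nu>) \<le> \<tau> * (1 / 2 + 4 / \<nu>)"
          using assms by (simp add: \<tau>_def field_simps)
        then show ?thesis
          using c d by (intro mult_left_mono mult_right_mono powr_mono) auto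
      qed
      also have "\<dots> \<le> real N"
        using that d \<epsilon> by (intro bound) (auto simp: \<epsilon>\<^sub>1_def)
      finally show ?thesis .
    qed
    with rate tc(1,2) x show ?thesis
      unfolding x_def[symmetric] by auto
  qed
  show "\<exists>c>0. \<exists>p::nat. \<exists>\<epsilon>\<^sub>0>0. \<epsilon>\<^sub>0 < 1 \<and> (\<forall>d\<ge>1. \<forall>\<epsilon>. 0 < \<epsilon> \<and> \<epsilon> \<le> \<epsilon>\<^sub>0 \<longrightarrow>
          \<nu> < tau_choice \<nu> d \<epsilon> \<and> tau_choice \<nu> d \<epsilon> < 1 \<and>
          iteration_rate \<nu> (tau_choice \<nu> d \<epsilon>) d \<epsilon> \<ge> c * ?Q d \<epsilon> / ln (real d / \<epsilon>) ^ p \<and>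
          (\<forall>\<eta> \<rho>\<^sub>0 N. step_size_order c\<^sub>1 c\<^sub>2 d \<nu> \<eta> \<and> bounded_init d C\<^sub>0 \<rho>\<^sub>0 \<and>
             tv_dist (target d \<nu>) (sampler_law d (target_pdf d \<nu>) \<eta> \<rho>\<^sub>0 N) \<le> \<epsilon> \<longrightarrow>
             real N \<ge> c * ?Q d \<epsilon> / ln (real d / \<epsilon>) ^ p))"
  proof (rule exI[of _ "min c 1"], rule conjI, use c in simp, rule exI[of _ p], rule exI[of _ \<epsilon>\<^sub>1],
      intro conjI[OF \<open>\<epsilon>\<^sub>1 > 0\<close>] conjI[OF \<open>\<epsilon>\<^sub>1 < 1\<close>] allI impI)
    fix d :: nat and \<epsilon> :: real
    assume "1 \<le> d" "0 < \<epsilon> \<and> \<epsilon> \<le> \<epsilon>\<^sub>1"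
    then show "\<nu> < tau_choice \<nu> d \<epsilon> \<and> tau_choice \<nu> d \<epsilon> < 1 \<and>
          iteration_rate \<nu> (tau_choice \<nu> d \<epsilon>) d \<epsilon> \<ge> min c 1 * ?Q d \<epsilon> / ln (real d / \<epsilon>) ^ p \<and>
          (\<forall>\<eta> \<rho>\<^sub>0 N. step_size_order c\<^sub>1 c\<^sub>2 d \<nu> \<eta> \<and> bounded_init d C\<^sub>0 \<rho>\<^sub>0 \<and>
             tv_dist (target d \<nu>) (sampler_law d (target_pdf d \<nu>) \<eta> \<rho>\<^sub>0 N) \<le> \<epsilon> \<longrightarrow>
             real N \<ge> min c 1 * ?Q d \<epsilon> / ln (real d / \<epsilon>) ^ p)"
      using main[of d \<epsilon>] unfolding conj_assoc by blast
  qed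
qed

end
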